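(* Let $G$ be a locally compact group. Then the augmentation ideal $L^1_0(G)$ is finitely-generated as a left ideal of $L^1(G)$ if and only if $G$ is finite.
   Context: $L^1(G)$ is the group algebra of $G$ with respect to left Haar measure $m$, a Banach algebra under convolution. The augmentation ideal is $L^1_0(G)=\{f\in L^1(G):\int_G f\,\mathrm{d}m=0\}$. For an algebra $A$, $A^\sharp$ denotes its conditional unitisation ($A^\sharp=A$ if $A$ is unital; otherwise $A^\sharp$ is $A$ with an identity adjoined). A left ideal $I$ of $A$ is finitely-generated if there exist $n\in\mathbb{N}$ and $x_1,\ldots,x_n\in A$ with $I=A^\sharp x_1+\cdots+A^\sharp x_n$ (purely algebraically, no closure is taken). *)

theory Defs
  imports "HOL-Analysis.Analysis" "HOL-Algebra.Congruence"
begin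

section \<open>Complex algebras, not necessarily unital\<close>

record 'a calgebra = "'a partial_object" +
  amult :: "'a \<Rightarrow> 'a \<Rightarrow> 'a"
  aadd :: "'a \<Rightarrow> 'a \<Rightarrow> 'a"
  azero :: 'a
  ascale :: "complex \<Rightarrow> 'a \<Rightarrow> 'a"

definition unital :: "'a calgebra \<Rightarrow> bool" where
  "unital A \<longleftrightarrow> (\<exists>e\<in>carrier A. \<forall>a\<in>carrier A. amult A e a = a \<and> amult A a e = a)"

text \<open>The pair \<open>(a, s)\<close> stands for \<open>a + s 1\<close>, where \<open>1\<close> is the adjoined identity.\<close>

definition unitisation :: "'a calgebra \<Rightarrow> ('a \<times> complex) calgebra" where
  "unitisation A =
    \<lparr>carrier = carrier A \<times> UNIV,
     amult = (\<lambda>(a, s) (b, t). (aadd A (amult A a b) (aadd A (ascale A s b) (ascale A t a)), s * t)),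
     aadd = (\<lambda>(a, s) (b, t). (aadd A a b, s + t)),
     azero = (azero A, 0),
     ascale = (\<lambda>r (a, s). (ascale A r a, r * s))\<rparr>"

text \<open>To have a single type in both cases, a unital \<open>A\<close> is represented by its copy
  \<open>A \<times> {0}\<close> inside the unitisation.\<close>

definition cond_unitisation :: "'a calgebra \<Rightarrow> ('a \<times> complex) calgebra" where
  "cond_unitisation A =
    (if unital A then (unitisation A)\<lparr>carrier := carrier A \<times> {0}\<rparr> else unitisation A)"

text \<open>The set \<open>A\<^sup>\<sharp> x\<close>; the product is formed in \<open>A\<^sup>\<sharp>\<close> and lies in the copy
  \<open>A \<times> {0}\<close> of \<open>A\<close>.\<close>

definition left_multiples :: "'a calgebra \<Rightarrow> 'a \<Rightarrow> 'a set" where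
  "left_multiples A x =
    {y \<in> carrier A. \<exists>u\<in>carrier (cond_unitisation A).
        amult (cond_unitisation A) u (x, 0) = (y, 0)}"

definition sum_sets :: "'a calgebra \<Rightarrow> 'a set \<Rightarrow> 'a set \<Rightarrow> 'a set" where
  "sum_sets A S T = {aadd A a b | a b. a \<in> S \<and> b \<in> T}"

definition left_ideal :: "'a calgebra \<Rightarrow> 'a set \<Rightarrow> bool" where
  "left_ideal A I \<longleftrightarrow>
     I \<subseteq> carrier A \<and> azero A \<in> I \<and>
     (\<forall>a\<in>I. \<forall>b\<in>I. aadd A a b \<in> I) \<and>
     (\<forall>s. \<forall>a\<in>I. ascale A s a \<in> I) \<and>
     (\<forall>a\<in>carrier A. \<forall>b\<in>I. amult A a b \<in> I)"

definition finitely_generated_left_ideal :: "'a calgebra \<Rightarrow> 'a set \<Rightarrow> bool" where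
  "finitely_generated_left_ideal A I \<longleftrightarrow>
     left_ideal A I \<and>
     (\<exists>xs. set xs \<subseteq> carrier A \<and>
        I = foldr (sum_sets A) (map (left_multiples A) xs) {azero A})"


section \<open>Left Haar measure\<close>

text \<open>Groups are written additively, since the library's class of topological groups is
  \<open>topological_group_add\<close>. Commutativity is not assumed.\<close>

definition left_haar_measure :: "'g::{topological_group_add,t2_space} measure \<Rightarrow> bool" where
  "left_haar_measure m \<longleftrightarrow>
     sets m = sets borel \<and>
     (\<forall>K. compact K \<longrightarrow> emeasure m K < \<infinity>) \<and>
     (\<forall>E\<in>sets borel. emeasure m E = (INF U\<in>{U. open U \<and> E \<subseteq> U}. emeasure m U)) \<and>
     (\<forall>U. open U \<longrightarrow> emeasure m U = (SUP K\<in>{K. compact K \<and> K \<subseteq> U}. emeasure m K)) \<and>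
     emeasure m UNIV \<noteq> 0 \<and>
     (\<forall>x. \<forall>E\<in>sets borel. emeasure m ((+) x ` E) = emeasure m E)"


section \<open>The group algebra and its augmentation ideal\<close>

definition ae_rel :: "'g measure \<Rightarrow> (('g \<Rightarrow> complex) \<times> ('g \<Rightarrow> complex)) set" where
  "ae_rel m = {(f, g). integrable m f \<and> integrable m g \<and> (AE x in m. f x = g x)}"

definition L1_class :: "'g measure \<Rightarrow> ('g \<Rightarrow> complex) \<Rightarrow> ('g \<Rightarrow> complex) set" where
  "L1_class m f = ae_rel m `` {f}"

text \<open>Additive form of \<open>(f * g)(x) = \<integral> f(y) g(y\<^sup>-\<^sup>1 x) dm(y)\<close>.\<close>

definition convolution ::
    "'g::group_add measure \<Rightarrow> ('g \<Rightarrow> complex) \<Rightarrow> ('g \<Rightarrow> complex) \<Rightarrow> 'g \<Rightarrow> complex" where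
  "convolution m f g x = (LINT y|m. f y * g (- y + x))"

text \<open>The operations on classes do not depend on representatives, so the unions below are
  unions of a single class.\<close>

definition L1_algebra :: "'g::group_add measure \<Rightarrow> ('g \<Rightarrow> complex) set calgebra" where
  "L1_algebra m =
    \<lparr>carrier = {f. integrable m f} // ae_rel m,
     amult = (\<lambda>F G. \<Union>f\<in>F. \<Union>g\<in>G. L1_class m (convolution m f g)),
     aadd = (\<lambda>F G. \<Union>f\<in>F. \<Union>g\<in>G. L1_class m (\<lambda>x. f x + g x)),
     azero = L1_class m (\<lambda>x. 0),
     ascale = (\<lambda>s F. \<Union>f\<in>F. L1_class m (\<lambda>x. s * f x))\<rparr>"

definition augmentation_ideal :: "'g::group_add measure \<Rightarrow> ('g \<Rightarrow> complex) set set" where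
  "augmentation_ideal m = L1_class m ` {f. integrable m f \<and> (LINT x|m. f x) = 0}"

end

theory Submission
  imports Defs
begin

text \<open>
  If \<open>G\<close> is finite, then \<open>L\<^sup>1(G)\<close> has an identity \<open>\<delta>\<close>, and \<open>e = \<delta> - 1 / m(G)\<close> is a right identity
  of the augmentation ideal, because \<open>f * 1\<close> is the constant \<open>\<integral> f\<close>. So the ideal is generated by \<open>e\<close>.

  For the converse, suppose that the ideal is generated by \<open>x\<^sub>1, \<dots>, x\<^sub>n\<close>. For a function \<open>\<phi>\<close> with
  \<open>\<bar>\<phi>\<bar> \<le> 1\<close>, let \<open>\<eta>(\<phi>)\<close> be a bound for \<open>\<bar>\<integral> \<phi> x\<^sub>i\<bar>\<close> and for the norm of the functionals
  \<open>a \<mapsto> \<integral> \<phi> (a * x\<^sub>i)\<close>. An element \<open>f = \<Sum>\<^sub>i (a\<^sub>i * x\<^sub>i + s\<^sub>i x\<^sub>i)\<close> of the ideal then satisfies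
  \<open>\<bar>\<integral> \<phi> f\<bar> \<le> N \<eta>(\<phi>)\<close> for all \<open>\<phi>\<close>, where \<open>N = \<Sum>\<^sub>i (\<parallel>a\<^sub>i\<parallel> + \<bar>s\<^sub>i\<bar>)\<close> does not depend on \<open>\<phi>\<close>. If \<open>G\<close> is infinite,
  there are \<open>\<phi>\<^sub>k\<close> with \<open>\<eta>(\<phi>\<^sub>k) \<le> 4\<^sup>-\<^sup>k\<close> and one \<open>f\<close> of integral zero with \<open>\<bar>\<integral> \<phi>\<^sub>k f\<bar> \<ge> C 2\<^sup>-\<^sup>k\<close>, where
  \<open>C > 0\<close>, which is a contradiction (\<open>test_sequence_contradiction\<close>). This replaces the open mapping
  theorem: \<open>f\<close> is a sum \<open>\<Sum>\<^sub>j 2\<^sup>-\<^sup>j f\<^sub>j\<close> in which \<open>f\<^sub>k\<close> pairs with \<open>\<phi>\<^sub>k\<close> to at least \<open>C\<close>, and all the pairings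
  of \<open>\<phi>\<^sub>k\<close> with the \<open>f\<^sub>j\<close> are nonnegative, so that nothing cancels.

  If points are null, \<open>\<phi>\<^sub>k\<close> is the indicator of a small neighbourhood \<open>E\<^sub>k\<close> of the identity and \<open>f\<^sub>k\<close> is,
  near the identity, the normalised indicator of \<open>E\<^sub>k\<close>: no finite set of generators can account
  for arbitrarily strong concentration at a point, since
  \<open>\<bar>\<integral>\<^bsub>E\<^esub> a * x\<bar> \<le> \<parallel>a\<parallel> sup\<^sub>y \<integral>\<^bsub>- y + E\<^esub> \<bar>x\<bar>\<close> and all the sets \<open>- y + E\<close> have measure \<open>m(E)\<close>.

  If points have positive mass, \<open>\<phi>\<^sub>k\<close> is a hat function with finite support and value \<open>1\<close> at the identity
  that varies by at most \<open>1 / n\<close> under right translation by any element of a finite set \<open>S\<close> that carries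
  almost all the mass of the generators; its pairing with \<open>a * x\<close> is small because \<open>\<integral> x = 0\<close>.
  Here \<open>f\<^sub>k = \<delta>\<^sub>0 - \<delta>\<^sub>g\<close> for a point \<open>g = g\<^sub>k\<close> outside the support of \<open>\<phi>\<^sub>k\<close>, and such a point exists
  because \<open>G\<close> is infinite.

  The group need not be second countable or \<open>\<sigma>\<close>-compact, so the Borel sets of \<open>G \<times> G\<close> need not lie in the
  product \<open>\<sigma>\<close>-algebra and \<open>m\<close> need not be \<open>\<sigma>\<close>-finite. The interchange of integrals behind the
  first estimate therefore rests on a Tonelli theorem for finite measures that are inner regular with
  respect to compact sets (\<open>tight_Tonelli\<close>).
\<close>

section \<open>Inner regularity of integrable densities\<close>

lemma
  assumes "left_haar_measure m"
  shows haar_sets: "sets m = sets borel" "space m = UNIV"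
    and haar_compact_finite: "compact K \<Longrightarrow> emeasure m K < \<infinity>"
    and haar_outer: "E \<in> sets borel \<Longrightarrow> emeasure m E = (INF U\<in>{U. open U \<and> E \<subseteq> U}. emeasure m U)"
    and haar_inner: "open U \<Longrightarrow> emeasure m U = (SUP K\<in>{K. compact K \<and> K \<subseteq> U}. emeasure m K)"
    and haar_nonzero: "emeasure m UNIV \<noteq> 0"
    and haar_translate: "E \<in> sets borel \<Longrightarrow> emeasure m ((+) x ` E) = emeasure m E"
  using assms sets_eq_imp_space_eq[of m borel] unfolding left_haar_measure_def by auto

lemma ennreal_add_less_half:
  assumes "a < ennreal (e / 2)" "b < ennreal (e / 2)"
  shows "a + b < ennreal e"
proof -
  have e: "0 < e" using assms(1) by (cases "0 < e") (auto simp: ennreal_neg)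
  have "a \<noteq> top" using assms(1) by (metis top.extremum_strict)
  then have "a + b < a + ennreal (e / 2)" using assms(2) by (simp add: ennreal_add_left_cancel_less)
  also have "\<dots> \<le> ennreal (e / 2) + ennreal (e / 2)" using assms(1) by (intro add_right_mono) simp
  also have "\<dots> = ennreal e" using e by (simp flip: ennreal_plus)
  finally show ?thesis .
qed

text \<open>
  The hypotheses give compact approximation from inside for open sets only. Shrink a compact
  \<open>C\<close> inside an open \<open>U \<supseteq> B\<close> by removing an open set \<open>V \<supseteq> U - B\<close> that is hardly larger than \<open>U - B\<close>;
  then \<open>C - V\<close> is compact, lies in \<open>B\<close> and misses little of it.
\<close>

lemma haar_compact_inside_finite:
  assumes m: "left_haar_measure m"
    and B: "B \<in> sets borel" "emeasure m B < \<infinity>" and e: "0 < (e::real)"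
  shows "\<exists>K. compact K \<and> K \<subseteq> B \<and> emeasure m (B - K) < e"
proof -
  note [measurable_cong, simp] = haar_sets[OF m]
  note outer = haar_outer[OF m] and inner = haar_inner[OF m]
  have e2: "0 < e / 2" using e by simp
  obtain U where U: "open U" "B \<subseteq> U" "emeasure m U < emeasure m B + e / 2"
    using INF_approx_ennreal[OF e2 outer[OF B(1)]] B by (auto simp: less_top)
  have Ufin: "emeasure m U < \<infinity>"
    using U(3) B(2) by (metis ennreal_add_eq_top ennreal_less_top infinity_ennreal_def less_top order_less_trans)
  obtain C where C: "compact C" "C \<subseteq> U" "emeasure m U < emeasure m C + e / 2"
    using SUP_approx_ennreal[OF e2 _ inner[OF U(1)]] Ufin by (auto simp: less_top)
  have [measurable]: "C \<in> sets borel" "U \<in> sets borel" "B \<in> sets borel"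
    using C U B compact_imp_closed by (auto intro!: borel_closed)
  have Cfin: "emeasure m C < \<infinity>" using haar_compact_finite[OF m C(1)] .
  have UB: "emeasure m (U - B) < e / 2"
    using U B by (subst emeasure_Diff) (auto simp: minus_less_iff_ennreal emeasure_mono add.commute[of _ "emeasure m B"])
  have UC: "emeasure m (U - C) < e / 2"
    using C Cfin by (subst emeasure_Diff) (auto simp: minus_less_iff_ennreal emeasure_mono add.commute[of _ "emeasure m C"])
  define d where "d = e / 2 - measure m (U - B)"
  have UBfin: "emeasure m (U - B) = ennreal (measure m (U - B))"
    using UB by (intro emeasure_eq_ennreal_measure) (metis top.extremum_strict)
  have d: "0 < d" using UB e unfolding d_def UBfin by (simp add: ennreal_less_iff)
  obtain V where V: "open V" "U - B \<subseteq> V" "emeasure m V < emeasure m (U - B) + d"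
    using INF_approx_ennreal[OF d outer[of "U - B"]] UBfin by (auto simp: less_top)
  then have [measurable]: "V \<in> sets borel" by auto
  have "emeasure m (V \<inter> B) + emeasure m (U - B) = emeasure m ((V \<inter> B) \<union> (U - B))"
    by (subst plus_emeasure) auto
  also have "\<dots> \<le> emeasure m V" using V by (intro emeasure_mono) auto
  also have "\<dots> < emeasure m (U - B) + d" by (rule V)
  finally have VB: "emeasure m (V \<inter> B) < d"
    by (metis add.commute ennreal_add_left_cancel_less)
  have "d \<le> e / 2" by (simp add: d_def)
  have "emeasure m (B - (C - V)) \<le> emeasure m ((U - C) \<union> (V \<inter> B))"
    using U by (intro emeasure_mono) auto
  also have "\<dots> \<le> emeasure m (U - C) + emeasure m (V \<inter> B)"
    by (intro emeasure_subadditive) auto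
  also have "\<dots> < e"
    using UC order_less_le_trans[OF VB ennreal_leI[OF \<open>d \<le> e / 2\<close>]] by (rule ennreal_add_less_half)
  finally have "emeasure m (B - (C - V)) < e" .
  moreover have "compact (C - V)" using C V by (simp add: compact_diff)
  moreover have "C - V \<subseteq> B" using C V by auto
  ultimately show ?thesis by blast
qed

text \<open>
  Truncate \<open>f\<close> at a height \<open>n\<close> that loses less than \<open>e / 2\<close> of the integral; the truncated part
  contributes at most \<open>n\<close> times the measure of \<open>E\<close>.
\<close>

lemma nn_integral_absolutely_continuous:
  assumes f[measurable]: "f \<in> borel_measurable M" and fin: "(\<integral>\<^sup>+x. f x \<partial>M) < \<infinity>" and e: "0 < (e::real)"
  shows "\<exists>d::real>0. \<forall>E\<in>sets M. emeasure M E < d \<longrightarrow> (\<integral>\<^sup>+x. f x * indicator E x \<partial>M) < e"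
proof -
  have inc: "incseq (\<lambda>n x. min (f x) (of_nat n))"
    by (auto simp: incseq_def le_fun_def intro: min.coboundedI2 min.mono)
  have sup: "(SUP n. min (f x) (of_nat n)) = f x" for x
  proof -
    have "(SUP n. min (f x) (of_nat n)) = min (f x) (SUP n. of_nat n)"
      by (simp add: inf_min[symmetric] inf_SUP)
    then show ?thesis by (simp add: ennreal_SUP_of_nat_eq_top)
  qed
  have "(\<integral>\<^sup>+x. f x \<partial>M) = (SUP n. \<integral>\<^sup>+x. min (f x) (of_nat n) \<partial>M)"
    using nn_integral_monotone_convergence_SUP[OF inc] sup by simp
  then obtain n where n: "(\<integral>\<^sup>+x. f x \<partial>M) < (\<integral>\<^sup>+x. min (f x) (of_nat n) \<partial>M) + e / 2"
    using SUP_approx_ennreal[of "e/2" UNIV] e fin by (auto simp: less_top)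
  have fin': "(\<integral>\<^sup>+x. min (f x) (of_nat n) \<partial>M) < \<infinity>"
    using fin by (auto intro!: order_le_less_trans[OF nn_integral_mono[of _ _ f]])
  have tail: "(\<integral>\<^sup>+x. (f x - min (f x) (of_nat n)) \<partial>M) < e / 2"
    using n fin' by (subst nn_integral_diff) (auto intro!: nn_integral_mono simp: minus_less_iff_ennreal[OF _ nn_integral_mono] add.commute)
  show ?thesis
  proof (intro exI[of _ "e / (2 * (n + 1))"] conjI ballI impI)
    show "0 < e / real (2 * (n + 1))" using e by simp
    fix E assume E[measurable]: "E \<in> sets M" "emeasure M E < e / real (2 * (n + 1))"
    have "(\<integral>\<^sup>+x. f x * indicator E x \<partial>M)
        \<le> (\<integral>\<^sup>+x. of_nat n * indicator E x + (f x - min (f x) (of_nat n)) \<partial>M)"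
      by (intro nn_integral_mono) (auto split: split_indicator simp: min_def add_increasing2 add_diff_inverse_ennreal)
    also have "\<dots> = of_nat n * emeasure M E + (\<integral>\<^sup>+x. (f x - min (f x) (of_nat n)) \<partial>M)"
      by (subst nn_integral_add) (auto simp: nn_integral_cmult)
    also have "\<dots> < e"
    proof (rule ennreal_add_less_half)
      have "of_nat n * emeasure M E \<le> of_nat n * ennreal (e / (2 * (n + 1)))"
        using E(2) by (intro mult_left_mono) auto
      also have "\<dots> = ennreal (n * (e / (2 * (n + 1))))"
        using e unfolding ennreal_of_nat_eq_real_of_nat by (intro ennreal_mult[symmetric]) auto
      also have "\<dots> < e / 2"
        using e by (intro ennreal_lessI) (auto simp: field_simps)
      finally show "of_nat n * emeasure M E < ennreal (e / 2)" .
    qed (rule tail)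
    finally show "(\<integral>\<^sup>+x. f x * indicator E x \<partial>M) < e" .
  qed
qed

text \<open>
  These are the finite Radon measures. Inner regularity is required for all Borel sets, which is
  the form that the proof of Tonelli's theorem uses.
\<close>

definition tight :: "'a::t2_space measure \<Rightarrow> bool" where
  "tight \<mu> \<longleftrightarrow> sets \<mu> = sets borel \<and> emeasure \<mu> UNIV < \<infinity> \<and>
     (\<forall>B\<in>sets borel. \<forall>e::real>0. \<exists>K. compact K \<and> K \<subseteq> B \<and> emeasure \<mu> (B - K) < e)"

text \<open>
  Haar measure itself need not be inner regular on sets of infinite measure, but up to a part of
  small integral a set \<open>B\<close> can be cut down to the points where \<open>f\<close> is at least \<open>1 / (n + 1)\<close>, and these
  form a set of finite measure.
\<close>

lemma tight_density:
  assumes m: "left_haar_measure m" and f[measurable]: "f \<in> borel_measurable borel"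
    and fin: "(\<integral>\<^sup>+x. f x \<partial>m) < \<infinity>"
  shows "tight (density m f)"
proof -
  note [measurable_cong, simp] = haar_sets[OF m]
  have fm[measurable]: "f \<in> borel_measurable m" by simp
  have dens: "emeasure (density m f) A = (\<integral>\<^sup>+x. f x * indicator A x \<partial>m)" if "A \<in> sets borel" for A
    using that by (simp add: emeasure_density)
  have "\<exists>K. compact K \<and> K \<subseteq> B \<and> emeasure (density m f) (B - K) < e"
    if B[measurable]: "B \<in> sets borel" and e: "0 < e" for B and e :: real
  proof -
    define D where "D n = B \<inter> {x. f x \<ge> ennreal (1 / Suc n)}" for n
    have D[measurable]: "D n \<in> sets borel" for n unfolding D_def by measurable
    have "incseq D"
    proof (intro incseq_SucI)
      fix n
      have "ennreal (1 / Suc (Suc n)) \<le> ennreal (1 / Suc n)" by (intro ennreal_leI) (simp add: frac_le)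
      then show "D n \<subseteq> D (Suc n)" unfolding D_def using order_trans by blast
    qed
    then have "(SUP n. emeasure (density m f) (D n)) = emeasure (density m f) (\<Union>n. D n)"
      by (intro SUP_emeasure_incseq) auto
    also have "\<dots> = emeasure (density m f) B"
    proof -
      have "x \<in> (\<Union>n. D n)" if "x \<in> B" "f x \<noteq> 0" for x
      proof -
        have "0 < f x" using that by (simp add: zero_less_iff_neq_zero)
        then obtain r :: real where r: "0 < r" "ennreal r < f x"
          using dense[OF \<open>0 < f x\<close>] by (metis ennreal_cases ennreal_less_zero_iff top.extremum_strict)
        obtain n where "1 / Suc n < r" using nat_approx_posE[OF r(1)] by blast
        then have "ennreal (1 / Suc n) \<le> f x"
          using r by (meson ennreal_leI less_imp_le order_trans)
        then show ?thesis using that by (auto simp: D_def)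
      qed
      then show ?thesis
        unfolding dens[OF B] using D
        by (subst dens) (auto intro!: nn_integral_cong split: split_indicator simp: D_def simp del: of_nat_Suc, blast+)
    qed
    finally have sup: "emeasure (density m f) B = (SUP n. emeasure (density m f) (D n))" by simp
    have Bfin: "emeasure (density m f) B < \<infinity>"
      using fin by (auto simp: dens intro!: order_le_less_trans[OF nn_integral_mono[of _ _ f]] split: split_indicator)
    obtain n where n: "emeasure (density m f) B < emeasure (density m f) (D n) + e / 2"
      using SUP_approx_ennreal[OF _ _ sup, of "e/2"] Bfin e by (auto simp: less_top)
    have Dfin: "emeasure m (D n) < \<infinity>"
    proof -
      have "ennreal (1 / Suc n) * emeasure m (D n) = (\<integral>\<^sup>+x. ennreal (1 / Suc n) * indicator (D n) x \<partial>m)"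
        by (subst nn_integral_cmult_indicator) auto
      also have "\<dots> \<le> (\<integral>\<^sup>+x. f x \<partial>m)"
        by (intro nn_integral_mono) (auto simp: D_def split: split_indicator)
      finally show ?thesis using fin
        by (auto simp: less_top[symmetric] ennreal_mult_eq_top_iff top_unique)
    qed
    obtain d :: real where d: "d > 0" "\<And>E. E \<in> sets m \<Longrightarrow> emeasure m E < d \<Longrightarrow> (\<integral>\<^sup>+x. f x * indicator E x \<partial>m) < e / 2"
      using nn_integral_absolutely_continuous[OF fm fin, of "e/2"] e by auto
    obtain K where K: "compact K" "K \<subseteq> D n" "emeasure m (D n - K) < d"
      using haar_compact_inside_finite[OF m D Dfin d(1)] by blast
    have [measurable]: "K \<in> sets borel" using K compact_imp_closed by (auto intro!: borel_closed)
    have "emeasure (density m f) (D n - K) < e / 2" using d(2)[of "D n - K"] K by (simp add: dens)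
    moreover have "emeasure (density m f) (B - D n) < e / 2"
    proof -
      have "emeasure (density m f) (D n) < \<infinity>"
        using Bfin by (rule order_le_less_trans[rotated]) (auto intro!: emeasure_mono simp: D_def)
      then show ?thesis using n
        by (subst emeasure_Diff) (auto simp: minus_less_iff_ennreal add.commute emeasure_mono D_def)
    qed
    moreover have "emeasure (density m f) (B - K) \<le> emeasure (density m f) (D n - K) + emeasure (density m f) (B - D n)"
      by (intro order_trans[OF emeasure_mono emeasure_subadditive]) auto
    ultimately have "emeasure (density m f) (B - K) < e"
      by (meson ennreal_add_less_half le_less_trans)
    then show ?thesis using K by (auto simp: D_def)
  qed
  then show ?thesis using fin by (auto simp: tight_def dens)
qed

section \<open>Tonelli's theorem for tight measures\<close>

lemma tightD:
  assumes "tight \<mu>"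
  shows "sets \<mu> = sets borel" "space \<mu> = UNIV" "finite_measure \<mu>"
  using assms sets_eq_imp_space_eq[of \<mu> borel]
  by (auto simp: tight_def intro!: finite_measureI)

lemma slice_measurable [measurable]:
  fixes W :: "('a::topological_space \<times> 'b::topological_space) set"
  assumes W: "W \<in> sets borel"
  shows "Pair y -` W \<in> sets borel" "(\<lambda>y. (y, z)) -` W \<in> sets borel"
proof -
  have "Pair y \<in> borel_measurable borel" "(\<lambda>y. (y, z)) \<in> borel_measurable borel"
    by (auto intro!: borel_measurable_continuous_onI continuous_intros)
  from this[THEN measurable_sets, OF W] show "Pair y -` W \<in> sets borel" "(\<lambda>y. (y, z)) -` W \<in> sets borel"
    by auto
qed

text \<open>
  Approximate the slice at \<open>y\<close> from inside by a compact set \<open>C\<close>; by the tube lemma \<open>C\<close> remains in the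
  slices at all points near \<open>y\<close>.
\<close>

lemma slice_box:
  fixes W :: "('a::t2_space \<times> 'b::t2_space) set"
  assumes \<nu>: "tight \<nu>" and W: "open W" and c: "c < emeasure \<nu> (Pair y -` W)"
  shows "\<exists>V C. open V \<and> y \<in> V \<and> compact C \<and> V \<times> C \<subseteq> W \<and> c < emeasure \<nu> C"
proof -
  note [simp] = tightD[OF \<nu>]
  interpret \<nu>: finite_measure \<nu> by (rule tightD[OF \<nu>])
  let ?W = "Pair y -` W"
  have [measurable]: "?W \<in> sets borel" using W by (intro slice_measurable) auto
  obtain c' where c': "c = ennreal c'" "0 \<le> c'"
    using c by (metis ennreal_cases top.extremum_strict)
  have pos: "0 < measure \<nu> ?W - c'"
    using c c' by (simp add: \<nu>.emeasure_eq_measure ennreal_less_iff)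
  obtain C where C: "compact C" "C \<subseteq> ?W" "emeasure \<nu> (?W - C) < measure \<nu> ?W - c'"
    using \<nu> pos unfolding tight_def by (meson \<open>?W \<in> sets borel\<close>)
  have [measurable]: "C \<in> sets borel" using C compact_imp_closed by (auto intro!: borel_closed)
  have "c < emeasure \<nu> C"
    using C(2,3) pos unfolding c'(1) \<nu>.emeasure_eq_measure
    using \<nu>.finite_measure_mono[of C ?W] by (auto simp: \<nu>.finite_measure_Diff ennreal_less_iff c'(2))
  moreover have "{y} \<times> C \<subseteq> W" using C by auto
  from Elementary_Topology.tube_lemma[OF C(1) W this] obtain V where "y \<in> V" "open V" "V \<times> C \<subseteq> W" by blast
  ultimately show ?thesis using C by blast
qed

lemma slice_open:
  fixes W :: "('a::t2_space \<times> 'b::t2_space) set"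
  assumes \<nu>: "tight \<nu>" and W: "open W"
  shows "open {y. c < emeasure \<nu> (Pair y -` W)}"
proof (subst open_subopen, safe)
  fix y assume "c < emeasure \<nu> (Pair y -` W)"
  from slice_box[OF \<nu> W this] obtain V C where V: "open V" "y \<in> V" "V \<times> C \<subseteq> W" "c < emeasure \<nu> C" by blast
  have "c < emeasure \<nu> (Pair y' -` W)" if "y' \<in> V" for y'
    using V that slice_measurable(1)[of W y'] W tightD[OF \<nu>]
    by (intro order_less_le_trans[OF V(4) emeasure_mono]) auto
  then show "\<exists>T. open T \<and> y \<in> T \<and> T \<subseteq> {y. c < emeasure \<nu> (Pair y -` W)}"
    using V by blast
qed

text \<open>
  Finitely many of the boxes from \<open>slice_box\<close> serve all points of a compact set. Their union lies in
  the product \<open>\<sigma>\<close>-algebra, whereas \<open>W\<close> need not.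
\<close>

lemma slice_boxes_compact:
  fixes W :: "('a::t2_space \<times> 'b::t2_space) set"
  assumes \<nu>: "tight \<nu>" and W: "open W" and K: "compact K" "K \<subseteq> {y. c < emeasure \<nu> (Pair y -` W)}"
  shows "\<exists>R\<in>sets (borel \<Otimes>\<^sub>M borel). R \<subseteq> W \<and> (\<forall>y\<in>K. c < emeasure \<nu> (Pair y -` R))"
proof -
  have "\<forall>y\<in>K. \<exists>V C. open V \<and> y \<in> V \<and> compact C \<and> V \<times> C \<subseteq> W \<and> c < emeasure \<nu> C"
    using slice_box[OF \<nu> W] K by blast
  then obtain V C where VC: "\<And>y. y \<in> K \<Longrightarrow> open (V y) \<and> y \<in> V y \<and> compact (C y) \<and> V y \<times> C y \<subseteq> W \<and> c < emeasure \<nu> (C y)"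
    by metis
  obtain F where F: "F \<subseteq> K" "finite F" "K \<subseteq> \<Union>(V ` F)"
    by (rule compactE_image[OF K(1), of K V]) (use VC in auto)
  let ?R = "\<Union>y\<in>F. V y \<times> C y"
  have Cb: "C y \<in> sets borel" if "y \<in> F" for y
    using VC F that compact_imp_closed by (intro borel_closed) blast
  have R: "?R \<in> sets (borel \<Otimes>\<^sub>M borel)"
    using F VC Cb by (intro sets.finite_UN pair_measureI) (auto intro!: borel_open)
  have "c < emeasure \<nu> (Pair y -` ?R)" if yK: "y \<in> K" for y
  proof -
    obtain x where x: "x \<in> F" "y \<in> V x" using F(3) yK by blast
    have "Pair y -` ?R \<in> sets \<nu>" using sets_Pair1[OF R, of y] tightD[OF \<nu>] by simp
    then have "emeasure \<nu> (C x) \<le> emeasure \<nu> (Pair y -` ?R)"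
      using x by (intro emeasure_mono) auto
    moreover have "c < emeasure \<nu> (C x)" using VC F x by blast
    ultimately show ?thesis by (rule order_less_le_trans[rotated])
  qed
  moreover have "?R \<subseteq> W" by (intro UN_least) (use VC F in blast)
  ultimately show ?thesis using R by blast
qed

text \<open>
  Apply the preceding lemma to compact sets that exhaust each superlevel set \<open>U q\<close> of the slice
  measure up to a null set. For rational \<open>q\<close> this takes only countably many boxes, and they capture
  almost all of almost every slice.
\<close>

lemma open_inner_boxes:
  fixes W :: "('a::t2_space \<times> 'b::t2_space) set"
  assumes \<mu>: "tight \<mu>" and \<nu>: "tight \<nu>" and W: "open W"
  shows "\<exists>R\<in>sets (borel \<Otimes>\<^sub>M borel). R \<subseteq> W \<and> (AE y in \<mu>. AE z in \<nu>. (y, z) \<in> R \<longleftrightarrow> (y, z) \<in> W)"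
proof -
  note [simp] = tightD[OF \<nu>] tightD[OF \<mu>]
  interpret \<nu>: finite_measure \<nu> by (rule tightD[OF \<nu>])
  interpret \<mu>: finite_measure \<mu> by (rule tightD[OF \<mu>])
  define U where "U q = {y. ennreal q < emeasure \<nu> (Pair y -` W)}" for q :: real
  have U[measurable]: "U q \<in> sets borel" for q using slice_open[OF \<nu> W] by (auto simp: U_def)
  have "\<exists>K. compact K \<and> K \<subseteq> U q \<and> emeasure \<mu> (U q - K) < ennreal (1 / Suc n)" for q :: real and n :: nat
    using \<mu> U[of q] by (auto simp: tight_def)
  then obtain K where K: "\<And>q n. compact (K q n)" "\<And>q n. K q n \<subseteq> U q" "\<And>q n. emeasure \<mu> (U q - K q n) < ennreal (1 / Suc n)"
    by metis
  have Kb[measurable]: "K q n \<in> sets borel" for q n using K compact_imp_closed by (intro borel_closed) blast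
  have "\<exists>R\<in>sets (borel \<Otimes>\<^sub>M borel). R \<subseteq> W \<and> (\<forall>y\<in>K q n. ennreal q < emeasure \<nu> (Pair y -` R))" for q :: real and n
    using slice_boxes_compact[OF \<nu> W K(1)[of q n]] K(2)[of q n] by (simp add: U_def)
  then obtain R where R: "\<And>q n. R q n \<in> sets (borel \<Otimes>\<^sub>M borel)" "\<And>q n. R q n \<subseteq> W"
    "\<And>q n y. y \<in> K q n \<Longrightarrow> ennreal q < emeasure \<nu> (Pair y -` R q n)"
    by metis
  define S where "S = (\<Union>q\<in>\<rat>. \<Union>n. R q n)"
  have S: "S \<in> sets (borel \<Otimes>\<^sub>M borel)" "S \<subseteq> W"
    unfolding S_def using R(1) R(2)[THEN subsetD] countable_rat by (auto intro!: sets.countable_UN')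
  have slS[measurable]: "Pair y -` S \<in> sets borel" for y using sets_Pair1[OF S(1), of y] by simp
  have slW[measurable]: "Pair y -` W \<in> sets borel" for y using W by (intro slice_measurable) auto
  \<comment> \<open>At a point outside \<open>N\<close>, every rational below the slice measure of \<open>W\<close> is below that of \<open>S\<close>.\<close>
  define N where "N = (\<Union>q\<in>\<rat>. U q - (\<Union>n. K q n))"
  have "U q - (\<Union>n. K q n) \<in> null_sets \<mu>" for q
  proof (rule null_setsI)
    have "emeasure \<mu> (U q - (\<Union>n. K q n)) \<le> ennreal e" if e: "0 < e" for e
    proof -
      obtain n where "1 / Suc n < e" using nat_approx_posE[OF e] by blast
      then have "ennreal (1 / Suc n) \<le> ennreal e" by (intro ennreal_leI) simp
      moreover have "emeasure \<mu> (U q - (\<Union>n. K q n)) \<le> emeasure \<mu> (U q - K q n)"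
        by (intro emeasure_mono) auto
      ultimately show ?thesis using K(3)[of q n] by (meson less_imp_le order_trans)
    qed
    then show "emeasure \<mu> (U q - (\<Union>n. K q n)) = 0"
      by (metis add.left_neutral ennreal_le_epsilon le_zero_eq)
  qed auto
  then have N: "N \<in> null_sets \<mu>" unfolding N_def by (intro null_sets_UN' countable_rat) auto
  have main: "AE z in \<nu>. (y, z) \<in> S \<longleftrightarrow> (y, z) \<in> W" if yN: "y \<notin> N" for y
  proof -
    have "measure \<nu> (Pair y -` W) \<le> measure \<nu> (Pair y -` S)"
    proof (rule ccontr)
      assume "\<not> ?thesis"
      then obtain q where q: "q \<in> \<rat>" "measure \<nu> (Pair y -` S) < q" "q < measure \<nu> (Pair y -` W)"
        using Rats_dense_in_real by (meson linorder_not_less)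
      have "0 \<le> q" using q(2) by (meson less_imp_le measure_nonneg order_trans)
      then have "y \<in> U q" using q by (simp add: U_def \<nu>.emeasure_eq_measure ennreal_less_iff)
      then obtain n where "y \<in> K q n" using yN q by (auto simp: N_def)
      then have "ennreal q < emeasure \<nu> (Pair y -` R q n)" by (rule R)
      also have "\<dots> \<le> emeasure \<nu> (Pair y -` S)"
        using q(1) slS[of y] by (intro emeasure_mono) (auto simp: S_def simp del: vimage_UN)
      finally show False using q \<open>0 \<le> q\<close> by (simp add: \<nu>.emeasure_eq_measure ennreal_less_iff)
    qed
    moreover have "measure \<nu> (Pair y -` W - Pair y -` S) = measure \<nu> (Pair y -` W) - measure \<nu> (Pair y -` S)"
      using S by (intro \<nu>.finite_measure_Diff) auto
    ultimately have "measure \<nu> (Pair y -` W - Pair y -` S) = 0"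
      by (metis diff_ge_0_iff_ge le_iff_diff_le_0 measure_nonneg order_antisym)
    then have "Pair y -` W - Pair y -` S \<in> null_sets \<nu>"
      by (intro null_setsI) (auto simp: \<nu>.emeasure_eq_measure)
    then show ?thesis by (rule AE_I') (use S in auto)
  qed
  have "AE y in \<mu>. y \<notin> N" using N by (rule AE_not_in)
  then have "AE y in \<mu>. AE z in \<nu>. (y, z) \<in> S \<longleftrightarrow> (y, z) \<in> W"
    by (rule eventually_mono) (rule main)
  then show ?thesis using S by blast
qed

lemma open_swap:
  fixes W :: "('a::topological_space \<times> 'b::topological_space) set"
  assumes "open W" shows "open (prod.swap -` W)"
  using assms by (rule open_vimage) (auto simp: prod.swap_def intro!: continuous_intros)

lemma open_product_measurable_up_to_null:
  fixes W :: "('a::t2_space \<times> 'b::t2_space) set"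
  assumes \<mu>: "tight \<mu>" and \<nu>: "tight \<nu>" and W: "open W"
  shows "\<exists>R\<in>sets (borel \<Otimes>\<^sub>M borel). (AE y in \<mu>. AE z in \<nu>. (y, z) \<in> R \<longleftrightarrow> (y, z) \<in> W) \<and>
     (AE z in \<nu>. AE y in \<mu>. (y, z) \<in> R \<longleftrightarrow> (y, z) \<in> W)"
proof -
  obtain R where R: "R\<in>sets (borel \<Otimes>\<^sub>M borel)" "R \<subseteq> W" "AE y in \<mu>. AE z in \<nu>. (y, z) \<in> R \<longleftrightarrow> (y, z) \<in> W"
    using open_inner_boxes[OF \<mu> \<nu> W] by blast
  obtain S where S: "S\<in>sets (borel \<Otimes>\<^sub>M borel)" "S \<subseteq> prod.swap -` W" "AE z in \<nu>. AE y in \<mu>. (z, y) \<in> S \<longleftrightarrow> (y, z) \<in> W"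
    using open_inner_boxes[OF \<nu> \<mu> open_swap[OF W]] by auto
  have "prod.swap -` S \<in> sets (borel \<Otimes>\<^sub>M borel)"
    using measurable_sets[OF measurable_pair_swap'[of borel borel] S(1)]
    by (simp add: space_pair_measure prod.swap_def[abs_def] case_prod_beta')
  then have "R \<union> prod.swap -` S \<in> sets (borel \<Otimes>\<^sub>M borel)" using R by auto
  moreover have "AE y in \<mu>. AE z in \<nu>. (y, z) \<in> R \<union> prod.swap -` S \<longleftrightarrow> (y, z) \<in> W"
    using R(3) by (rule eventually_mono) (elim eventually_mono, use R S in auto)
  moreover have "AE z in \<nu>. AE y in \<mu>. (y, z) \<in> R \<union> prod.swap -` S \<longleftrightarrow> (y, z) \<in> W"
    using S(3) by (rule eventually_mono) (elim eventually_mono, use R S in auto)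
  ultimately show ?thesis by blast
qed

lemma AE_AE_mono:
  assumes "AE y in \<mu>. AE z in \<nu>. P y z" "\<And>y z. P y z \<Longrightarrow> Q y z"
  shows "AE y in \<mu>. AE z in \<nu>. Q y z"
  using assms by (auto elim!: eventually_mono)

lemma AE_AE_conj:
  assumes "AE y in \<mu>. AE z in \<nu>. P y z" "AE y in \<mu>. AE z in \<nu>. Q y z"
  shows "AE y in \<mu>. AE z in \<nu>. P y z \<and> Q y z"
  using assms by (auto intro: eventually_elim2)

text \<open>
  Having a representative in the product \<open>\<sigma>\<close>-algebra that agrees slice by slice, in both orders,
  is preserved by complements and countable unions, so it passes from open sets to Borel sets.
\<close>

lemma borel_product_measurable_up_to_null:
  fixes W :: "('a::t2_space \<times> 'b::t2_space) set"
  assumes \<mu>: "tight \<mu>" and \<nu>: "tight \<nu>" and W: "W \<in> sets borel"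
  shows "\<exists>R\<in>sets (borel \<Otimes>\<^sub>M borel). (AE y in \<mu>. AE z in \<nu>. (y, z) \<in> R \<longleftrightarrow> (y, z) \<in> W) \<and>
     (AE z in \<nu>. AE y in \<mu>. (y, z) \<in> R \<longleftrightarrow> (y, z) \<in> W)"
proof -
  from W have "W \<in> sigma_sets UNIV {S. open S}" by (simp add: borel_def)
  then show ?thesis
  proof induction
    case (Basic W)
    then show ?case using open_product_measurable_up_to_null[OF \<mu> \<nu>] by blast
  next
    case Empty
    then show ?case by (intro bexI[of _ "{}"]) auto
  next
    case (Compl W)
    then obtain R where R: "R \<in> sets (borel \<Otimes>\<^sub>M borel)" "AE y in \<mu>. AE z in \<nu>. (y, z) \<in> R \<longleftrightarrow> (y, z) \<in> W"
     "AE z in \<nu>. AE y in \<mu>. (y, z) \<in> R \<longleftrightarrow> (y, z) \<in> W" by blast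
    have "UNIV - R \<in> sets (borel \<Otimes>\<^sub>M borel)"
      using sets.compl_sets[OF R(1)] by (simp add: space_pair_measure)
    then show ?case using R(2,3) by (intro bexI[of _ "UNIV - R"]) auto
  next
    case (Union W)
    have "\<exists>R. \<forall>i. R i \<in> sets (borel \<Otimes>\<^sub>M borel) \<and> (AE y in \<mu>. AE z in \<nu>. (y, z) \<in> R i \<longleftrightarrow> (y, z) \<in> W i) \<and>
     (AE z in \<nu>. AE y in \<mu>. (y, z) \<in> R i \<longleftrightarrow> (y, z) \<in> W i)"
      using Union.IH by (intro choice) blast
    then obtain R where R: "\<And>i. R i \<in> sets (borel \<Otimes>\<^sub>M borel)" "\<And>i. AE y in \<mu>. AE z in \<nu>. (y, z) \<in> R i \<longleftrightarrow> (y, z) \<in> W i"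
     "\<And>i. AE z in \<nu>. AE y in \<mu>. (y, z) \<in> R i \<longleftrightarrow> (y, z) \<in> W i" by blast
    have "AE y in \<mu>. AE z in \<nu>. \<forall>i. (y, z) \<in> R i \<longleftrightarrow> (y, z) \<in> W i"
         "AE z in \<nu>. AE y in \<mu>. \<forall>i. (y, z) \<in> R i \<longleftrightarrow> (y, z) \<in> W i"
      using R by (auto simp: AE_all_countable)
    then show ?case using R(1)
      by (intro bexI[of _ "\<Union>i. R i"] conjI sets.countable_UN) (auto elim!: AE_AE_mono)
  qed
qed

text \<open>
  Replace \<open>f\<close> by a function that is measurable for the product \<open>\<sigma>\<close>-algebra and gives the same iterated
  integrals; for that one the usual Tonelli theorem applies.
\<close>

theorem tight_Tonelli:
  fixes f :: "'a::t2_space \<times> 'b::t2_space \<Rightarrow> ennreal"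
  assumes \<mu>: "tight \<mu>" and \<nu>: "tight \<nu>" and f: "f \<in> borel_measurable borel"
  shows "(\<integral>\<^sup>+y. \<integral>\<^sup>+z. f (y, z) \<partial>\<nu> \<partial>\<mu>) = (\<integral>\<^sup>+z. \<integral>\<^sup>+y. f (y, z) \<partial>\<mu> \<partial>\<nu>)"
proof -
  note [measurable_cong, simp] = tightD(1,2)[OF \<nu>] tightD(1,2)[OF \<mu>]
  interpret \<nu>: finite_measure \<nu> by (rule tightD[OF \<nu>])
  interpret \<mu>: finite_measure \<mu> by (rule tightD[OF \<mu>])
  interpret pair_sigma_finite \<mu> \<nu> by standard
  have "\<exists>g\<in>borel_measurable (borel \<Otimes>\<^sub>M borel). (AE y in \<mu>. AE z in \<nu>. g (y, z) = f (y, z)) \<and>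
     (AE z in \<nu>. AE y in \<mu>. g (y, z) = f (y, z))"
    using f
  proof (induction rule: borel_measurable_induct)
    case (cong f g)
    then show ?case by simp
  next
    case (set A)
    then obtain R where "R\<in>sets (borel \<Otimes>\<^sub>M borel)" "(AE y in \<mu>. AE z in \<nu>. (y, z) \<in> R \<longleftrightarrow> (y, z) \<in> A)"
     "(AE z in \<nu>. AE y in \<mu>. (y, z) \<in> R \<longleftrightarrow> (y, z) \<in> A)"
      using borel_product_measurable_up_to_null[OF \<mu> \<nu>] by blast
    then show ?case
      by (intro bexI[of _ "indicator R"] conjI) (auto elim!: AE_AE_mono split: split_indicator)
  next
    case (mult u c)
    then obtain g where "g\<in>borel_measurable (borel \<Otimes>\<^sub>M borel)" "AE y in \<mu>. AE z in \<nu>. g (y, z) = u (y, z)"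
     "AE z in \<nu>. AE y in \<mu>. g (y, z) = u (y, z)" by blast
    then show ?case
      by (intro bexI[of _ "\<lambda>x. c * g x"] conjI) (auto elim!: AE_AE_mono)
  next
    case (add u v)
    then obtain g h where "g\<in>borel_measurable (borel \<Otimes>\<^sub>M borel)" "AE y in \<mu>. AE z in \<nu>. g (y, z) = u (y, z)"
     "AE z in \<nu>. AE y in \<mu>. g (y, z) = u (y, z)"
     "h\<in>borel_measurable (borel \<Otimes>\<^sub>M borel)" "AE y in \<mu>. AE z in \<nu>. h (y, z) = v (y, z)"
     "AE z in \<nu>. AE y in \<mu>. h (y, z) = v (y, z)" by blast
    moreover from this have "AE y in \<mu>. AE z in \<nu>. g (y, z) = u (y, z) \<and> h (y, z) = v (y, z)"
       "AE z in \<nu>. AE y in \<mu>. g (y, z) = u (y, z) \<and> h (y, z) = v (y, z)"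
      by (simp_all only: AE_AE_conj)
    then have "AE y in \<mu>. AE z in \<nu>. h (y, z) + g (y, z) = v (y, z) + u (y, z)"
       "AE z in \<nu>. AE y in \<mu>. h (y, z) + g (y, z) = v (y, z) + u (y, z)"
      by (auto elim: AE_AE_mono)
    ultimately show ?case
      by (intro bexI[of _ "\<lambda>x. h x + g x"] conjI) auto
  next
    case (seq U)
    have "\<exists>g. \<forall>i. g i\<in>borel_measurable (borel \<Otimes>\<^sub>M borel) \<and> (AE y in \<mu>. AE z in \<nu>. g i (y, z) = U i (y, z)) \<and>
     (AE z in \<nu>. AE y in \<mu>. g i (y, z) = U i (y, z))"
      using seq.IH by (intro choice) blast
    then obtain g where g: "\<And>i. g i\<in>borel_measurable (borel \<Otimes>\<^sub>M borel)" "\<And>i. AE y in \<mu>. AE z in \<nu>. g i (y, z) = U i (y, z)"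
     "\<And>i. AE z in \<nu>. AE y in \<mu>. g i (y, z) = U i (y, z)" by blast
    then have "AE y in \<mu>. AE z in \<nu>. \<forall>i. g i (y, z) = U i (y, z)" "AE z in \<nu>. AE y in \<mu>. \<forall>i. g i (y, z) = U i (y, z)"
      by (auto simp: AE_all_countable)
    then show ?case using g(1)
      by (intro bexI[of _ "\<lambda>x. SUP i. g i x"] conjI) (auto elim!: AE_AE_mono simp: image_comp)
  qed
  then obtain g where g: "g\<in>borel_measurable (borel \<Otimes>\<^sub>M borel)" "AE y in \<mu>. AE z in \<nu>. g (y, z) = f (y, z)"
     "AE z in \<nu>. AE y in \<mu>. g (y, z) = f (y, z)" by blast
  have gp: "g \<in> borel_measurable (\<mu> \<Otimes>\<^sub>M \<nu>)" using g(1) by simp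
  have "(\<integral>\<^sup>+y. \<integral>\<^sup>+z. f (y, z) \<partial>\<nu> \<partial>\<mu>) = (\<integral>\<^sup>+y. \<integral>\<^sup>+z. g (y, z) \<partial>\<nu> \<partial>\<mu>)"
    using g(2) by (intro nn_integral_cong_AE) (auto elim!: eventually_mono intro!: nn_integral_cong_AE)
  also have "\<dots> = (\<integral>\<^sup>+z. \<integral>\<^sup>+y. g (y, z) \<partial>\<mu> \<partial>\<nu>)"
    using Fubini[OF gp] by simp
  also have "\<dots> = (\<integral>\<^sup>+z. \<integral>\<^sup>+y. f (y, z) \<partial>\<mu> \<partial>\<nu>)"
    using g(3) by (intro nn_integral_cong_AE) (auto elim!: eventually_mono intro!: nn_integral_cong_AE)
  finally show ?thesis .
qed

section \<open>Testing the elements of a finitely generated left ideal\<close>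

lemma L1_class_iff:
  "g \<in> L1_class m f \<longleftrightarrow> integrable m f \<and> integrable m g \<and> (AE x in m. f x = g x)"
  by (auto simp: L1_class_def ae_rel_def)

lemma L1_carrier:
  assumes "F \<in> carrier (L1_algebra m)" "f \<in> F"
  shows "integrable m f" "F = L1_class m f"
proof -
  obtain g where g: "integrable m g" "F = L1_class m g"
    using assms(1) by (auto simp: L1_algebra_def quotient_def L1_class_def)
  then have fg: "integrable m f" "AE x in m. g x = f x" using assms(2) by (auto simp: L1_class_iff)
  then show "integrable m f" by blast
  have "(AE x in m. g x = h x) \<longleftrightarrow> (AE x in m. f x = h x)" for h
    by (rule eventually_subst) (use fg(2) in eventually_elim, simp)
  then show "F = L1_class m f" using g fg by (auto simp: L1_class_iff)
qed

lemma L1_algebra_members: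
  "f \<in> aadd (L1_algebra m) F G \<longleftrightarrow> (\<exists>p\<in>F. \<exists>q\<in>G. f \<in> L1_class m (\<lambda>x. p x + q x))"
  "f \<in> amult (L1_algebra m) F G \<longleftrightarrow> (\<exists>p\<in>F. \<exists>q\<in>G. f \<in> L1_class m (convolution m p q))"
  "f \<in> ascale (L1_algebra m) s F \<longleftrightarrow> (\<exists>p\<in>F. f \<in> L1_class m (\<lambda>x. s * p x))"
  by (auto simp: L1_algebra_def)

text \<open>
  The number \<open>\<eta>\<close> bounds the functional \<open>f \<mapsto> \<integral> \<phi> f\<close> on the multiples of \<open>x\<close> by elements of the unitised
  algebra: the first conjunct treats the adjoined identity, the second one the elements \<open>a\<close> of the algebra.
\<close>

definition test_bound :: "'g::group_add measure \<Rightarrow> ('g \<Rightarrow> real) \<Rightarrow> real \<Rightarrow> ('g \<Rightarrow> complex) \<Rightarrow> bool" where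
  "test_bound m \<phi> \<eta> x \<longleftrightarrow>
     norm (LINT z|m. \<phi> z *\<^sub>R x z) \<le> \<eta> \<and>
     (\<forall>a. integrable m a \<longrightarrow> integrable m (convolution m a x) \<longrightarrow>
        norm (LINT z|m. \<phi> z *\<^sub>R convolution m a x z) \<le> \<eta> * (LINT y|m. norm (a y)))"

lemma integrable_bounded_scaleR:
  fixes f :: "'a \<Rightarrow> complex" and \<phi> :: "'a \<Rightarrow> real"
  assumes "integrable m f" "\<phi> \<in> borel_measurable m" "\<And>z. \<bar>\<phi> z\<bar> \<le> 1"
  shows "integrable m (\<lambda>z. \<phi> z *\<^sub>R f z)"
  using assms by (intro Bochner_Integration.integrable_bound[OF assms(1)])
    (auto intro!: mult_left_le_one_le)

text \<open>
  The product in the unitised algebra is \<open>(a, s) (x, 0) = (a * x + (s x + 0 a), 0)\<close>, whether or not the algebra is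
  unital, so \<open>N = \<parallel>a\<parallel> + \<bar>s\<bar>\<close> works for all test functions at once.
\<close>

lemma left_multiple_bound:
  fixes m :: "'g::group_add measure"
  assumes F: "F \<in> left_multiples (L1_algebra m) X"
  shows "\<exists>f\<in>F. integrable m f \<and> (\<exists>N. \<forall>\<phi> \<eta>. \<phi> \<in> borel_measurable m \<longrightarrow> (\<forall>z. \<bar>\<phi> z\<bar> \<le> 1) \<longrightarrow>
     (\<forall>x\<in>X. test_bound m \<phi> \<eta> x) \<longrightarrow> norm (LINT z|m. \<phi> z *\<^sub>R f z) \<le> N * \<eta>)"
proof -
  let ?A = "L1_algebra m"
  obtain a s where as: "(a, s) \<in> carrier (cond_unitisation ?A)" "amult (cond_unitisation ?A) (a, s) (X, 0) = (F, 0)"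
    and Fc: "F \<in> carrier ?A"
    using F by (auto simp: left_multiples_def)
  have ac: "a \<in> carrier ?A" using as(1) by (auto simp: cond_unitisation_def unitisation_def split: if_splits)
  have Feq: "F = aadd ?A (amult ?A a X) (aadd ?A (ascale ?A s X) (ascale ?A 0 a))"
    using as(2) by (auto simp: cond_unitisation_def unitisation_def split: if_splits)
  obtain f0 where f0: "F = L1_class m f0" "integrable m f0"
    using Fc by (auto simp: L1_algebra_def quotient_def L1_class_def)
  then have "f0 \<in> F" by (auto simp: L1_class_iff)
  then obtain h g where h: "h \<in> amult ?A a X" and g: "g \<in> aadd ?A (ascale ?A s X) (ascale ?A 0 a)"
    and f: "f0 \<in> L1_class m (\<lambda>x. h x + g x)"
    unfolding Feq L1_algebra_members(1)[of _ _ "amult ?A a X"] by blast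
  obtain a0 x0 where ax: "a0 \<in> a" "x0 \<in> X" "h \<in> L1_class m (convolution m a0 x0)"
    using h unfolding L1_algebra_members(2) by blast
  obtain p q where pq: "p \<in> ascale ?A s X" "q \<in> ascale ?A 0 a" "g \<in> L1_class m (\<lambda>x. p x + q x)"
    using g unfolding L1_algebra_members(1) by blast
  obtain x1 where x1: "x1 \<in> X" "p \<in> L1_class m (\<lambda>x. s * x1 x)"
    using pq(1) unfolding L1_algebra_members by blast
  obtain a1 where a1: "q \<in> L1_class m (\<lambda>x. 0 * a1 x)"
    using pq(2) unfolding L1_algebra_members by blast
  have a0: "integrable m a0" using L1_carrier[OF ac ax(1)] by blast
  have conv: "integrable m (convolution m a0 x0)" using ax(3) by (auto simp: L1_class_iff)
  have sx: "integrable m (\<lambda>x. s * x1 x)" using x1 by (auto simp: L1_class_iff)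
  have eq: "AE z in m. f0 z = convolution m a0 x0 z + s * x1 z"
    using f ax(3) pq(3) x1(2) a1 unfolding L1_class_iff by (auto elim!: eventually_elim2)
  have "norm (LINT z|m. \<phi> z *\<^sub>R f0 z) \<le> ((LINT y|m. norm (a0 y)) + norm s) * \<eta>"
    if \<phi>: "\<phi> \<in> borel_measurable m" "\<forall>z. \<bar>\<phi> z\<bar> \<le> 1" and tb: "\<forall>x\<in>X. test_bound m \<phi> \<eta> x"
    for \<phi> :: "'g \<Rightarrow> real" and \<eta> :: real
  proof -
    note ints = integrable_bounded_scaleR[OF conv \<phi>(1)] integrable_bounded_scaleR[OF sx \<phi>(1)]
    have "(LINT z|m. \<phi> z *\<^sub>R f0 z) = (LINT z|m. \<phi> z *\<^sub>R convolution m a0 x0 z + \<phi> z *\<^sub>R (s * x1 z))"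
      using eq f0(2) conv sx \<phi>(1)
      by (intro integral_cong_AE) (auto elim!: eventually_mono simp: scaleR_add_right)
    also have "\<dots> = (LINT z|m. \<phi> z *\<^sub>R convolution m a0 x0 z) + (LINT z|m. s * (\<phi> z *\<^sub>R x1 z))"
      using \<phi> ints by (subst Bochner_Integration.integral_add) auto
    also have "(LINT z|m. s * (\<phi> z *\<^sub>R x1 z)) = s * (LINT z|m. \<phi> z *\<^sub>R x1 z)"
      by (rule integral_mult_right_zero)
    finally have eq': "(LINT z|m. \<phi> z *\<^sub>R f0 z) =
      (LINT z|m. \<phi> z *\<^sub>R convolution m a0 x0 z) + s * (LINT z|m. \<phi> z *\<^sub>R x1 z)" .
    have "norm (LINT z|m. \<phi> z *\<^sub>R convolution m a0 x0 z) \<le> \<eta> * (LINT y|m. norm (a0 y))"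
      using tb ax(2) a0 conv by (auto simp: test_bound_def)
    moreover have "norm (s * (LINT z|m. \<phi> z *\<^sub>R x1 z)) \<le> norm s * \<eta>"
      using tb x1(1) unfolding norm_mult by (intro mult_left_mono) (auto simp: test_bound_def)
    ultimately show ?thesis unfolding eq' by (intro norm_triangle_le) (simp add: algebra_simps)
  qed
  then show ?thesis using \<open>f0 \<in> F\<close> f0(2) by blast
qed

lemma finite_combination_bound:
  fixes m :: "'g::group_add measure"
  assumes F: "F \<in> foldr (sum_sets (L1_algebra m)) (map (left_multiples (L1_algebra m)) Xs) {azero (L1_algebra m)}"
  shows "\<exists>f\<in>F. integrable m f \<and> (\<exists>N. \<forall>\<phi> \<eta>. \<phi> \<in> borel_measurable m \<longrightarrow> (\<forall>z. \<bar>\<phi> z\<bar> \<le> 1) \<longrightarrow>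
     (\<forall>X\<in>set Xs. \<forall>x\<in>X. test_bound m \<phi> \<eta> x) \<longrightarrow> norm (LINT z|m. \<phi> z *\<^sub>R f z) \<le> N * \<eta>)"
  using F
proof (induction Xs arbitrary: F)
  case Nil
  then have "(\<lambda>x. 0) \<in> F" by (auto simp: L1_algebra_def L1_class_iff)
  then show ?case by (intro bexI[of _ "\<lambda>x. 0"]) (auto intro!: exI[of _ 0])
next
  case (Cons X Xs)
  let ?A = "L1_algebra m"
  obtain P Q where PQ: "P \<in> left_multiples ?A X"
    "Q \<in> foldr (sum_sets ?A) (map (left_multiples ?A) Xs) {azero ?A}" "F = aadd ?A P Q"
    using Cons.prems unfolding list.map foldr_Cons o_apply sum_sets_def[of _ "left_multiples ?A X"] by blast
  obtain p N where p: "p \<in> P" "integrable m p" and N: "\<And>\<phi> \<eta>. \<phi> \<in> borel_measurable m \<Longrightarrow> (\<forall>z. \<bar>\<phi> z\<bar> \<le> 1) \<Longrightarrow>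
     (\<forall>x\<in>X. test_bound m \<phi> \<eta> x) \<Longrightarrow> norm (LINT z|m. \<phi> z *\<^sub>R p z) \<le> N * \<eta>"
    using left_multiple_bound[OF PQ(1)] by blast
  obtain q N' where q: "q \<in> Q" "integrable m q" and N': "\<And>\<phi> \<eta>. \<phi> \<in> borel_measurable m \<Longrightarrow> (\<forall>z. \<bar>\<phi> z\<bar> \<le> 1) \<Longrightarrow>
     (\<forall>X\<in>set Xs. \<forall>x\<in>X. test_bound m \<phi> \<eta> x) \<Longrightarrow> norm (LINT z|m. \<phi> z *\<^sub>R q z) \<le> N' * \<eta>"
    using Cons.IH[OF PQ(2)] by blast
  have "(\<lambda>x. p x + q x) \<in> F"
    unfolding PQ(3) L1_algebra_members using p q by (intro bexI[of _ p] bexI[of _ q]) (auto simp: L1_class_iff)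
  moreover have "norm (LINT z|m. \<phi> z *\<^sub>R (p z + q z)) \<le> (N + N') * \<eta>"
    if \<phi>: "\<phi> \<in> borel_measurable m" "\<forall>z. \<bar>\<phi> z\<bar> \<le> 1" and tb: "\<forall>X\<in>set (X # Xs). \<forall>x\<in>X. test_bound m \<phi> \<eta> x"
    for \<phi> :: "'g \<Rightarrow> real" and \<eta> :: real
  proof -
    have "(LINT z|m. \<phi> z *\<^sub>R (p z + q z)) = (LINT z|m. \<phi> z *\<^sub>R p z) + (LINT z|m. \<phi> z *\<^sub>R q z)"
      unfolding scaleR_add_right using p q \<phi>
      by (intro Bochner_Integration.integral_add integrable_bounded_scaleR) auto
    moreover have "norm (LINT z|m. \<phi> z *\<^sub>R p z) \<le> N * \<eta>" using tb by (intro N \<phi>) auto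
    moreover have "norm (LINT z|m. \<phi> z *\<^sub>R q z) \<le> N' * \<eta>" using tb by (intro N' \<phi>) auto
    ultimately show ?thesis by (simp only: distrib_right, intro norm_triangle_le add_mono)
  qed
  moreover have "integrable m (\<lambda>x. p x + q x)" using p q by simp
  ultimately show ?case by blast
qed

text \<open>
  By the preceding lemma the pairings with \<open>\<phi> k\<close> are at most \<open>N / 4 ^ k\<close>, with \<open>N\<close> independent of \<open>k\<close>; this is
  incompatible with \<open>c / 2 ^ k\<close> as a lower bound.
\<close>

lemma test_sequence_contradiction:
  fixes m :: "'g::group_add measure"
  assumes F: "L1_class m f \<in> foldr (sum_sets (L1_algebra m)) (map (left_multiples (L1_algebra m)) Xs) {azero (L1_algebra m)}"
    and \<phi>: "\<And>k. \<phi> k \<in> borel_measurable m" "\<And>k z. \<bar>\<phi> k z\<bar> \<le> 1"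
    and small: "\<And>k X x. X \<in> set Xs \<Longrightarrow> x \<in> X \<Longrightarrow> test_bound m (\<phi> k) ((1/4)^k) x"
    and large: "\<And>k::nat. c * (1/2)^k \<le> norm (LINT z|m. \<phi> k z *\<^sub>R f z)"
    and c: "0 < c"
  shows False
proof -
  obtain g N where g: "g \<in> L1_class m f" and N: "\<And>\<psi> \<eta>. \<psi> \<in> borel_measurable m \<Longrightarrow> (\<forall>z. \<bar>\<psi> z\<bar> \<le> 1) \<Longrightarrow>
     (\<forall>X\<in>set Xs. \<forall>x\<in>X. test_bound m \<psi> \<eta> x) \<Longrightarrow> norm (LINT z|m. \<psi> z *\<^sub>R g z) \<le> N * \<eta>"
    using finite_combination_bound[OF F] by blast
  have "c * 2 ^ k \<le> N" for k
  proof -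
    have "(LINT z|m. \<phi> k z *\<^sub>R f z) = (LINT z|m. \<phi> k z *\<^sub>R g z)"
      using g \<phi> by (intro integral_cong_AE) (auto simp: L1_class_iff elim!: eventually_mono)
    then have "c * (1/2)^k \<le> N * (1/4)^k"
      using large[of k] N[of "\<phi> k" "(1/4)^k"] \<phi> small by (metis order_trans)
    moreover have "(1/4::real)^k = (1/2)^k * (1/2)^k" by (simp flip: power_mult_distrib)
    ultimately have "c \<le> N * (1/2)^k" by simp
    then show ?thesis by (simp add: power_one_over field_simps)
  qed
  moreover obtain k where "N / c < 2 ^ k" using real_arch_pow[of 2 "N / c"] by auto
  ultimately show False using c by (metis divide_less_eq linorder_not_less mult.commute)
qed

lemma haar_translation_measurable [measurable]:
  "(+) y \<in> borel_measurable (borel :: 'g::topological_group_add measure)"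
  by (intro borel_measurable_continuous_onI continuous_intros)

text \<open>
  The preimage under translation by \<open>y\<close> is the image under translation by \<open>- y\<close>.
\<close>

lemma haar_distr:
  assumes m: "left_haar_measure m"
  shows "distr m m ((+) y) = m"
proof (rule measure_eqI)
  note [simp] = haar_sets[OF m]
  fix A assume "A \<in> sets (distr m m ((+) y))"
  then have A[measurable]: "A \<in> sets borel" by simp
  have "emeasure (distr m m ((+) y)) A = emeasure m ((+) y -` A)"
    using A by (subst emeasure_distr) (auto simp: measurable_def intro!: measurable_sets[OF haar_translation_measurable, simplified])
  also have "(+) y -` A = (+) (- y) ` A"
    by (force simp: image_iff add.assoc[symmetric])
  also have "emeasure m \<dots> = emeasure m A" by (rule haar_translate[OF m A])
  finally show "emeasure (distr m m ((+) y)) A = emeasure m A" .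
qed simp

lemma haar_nn_integral_translate:
  assumes m: "left_haar_measure m" and f: "f \<in> borel_measurable borel"
  shows "(\<integral>\<^sup>+z. f (y + z) \<partial>m) = (\<integral>\<^sup>+z. f z \<partial>m)"
proof -
  note [simp, measurable_cong] = haar_sets[OF m]
  have "(\<integral>\<^sup>+z. f z \<partial>m) = (\<integral>\<^sup>+z. f z \<partial>distr m m ((+) y))" by (simp add: haar_distr[OF m])
  also have "\<dots> = (\<integral>\<^sup>+z. f (y + z) \<partial>m)"
    using f by (subst nn_integral_distr) auto
  finally show ?thesis by simp
qed

lemma haar_integral_translate:
  fixes f :: "'g::{topological_group_add,t2_space} \<Rightarrow> complex"
  assumes m: "left_haar_measure m" and f: "f \<in> borel_measurable borel"
  shows "(LINT z|m. f (y + z)) = (LINT z|m. f z)"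
proof -
  note [simp, measurable_cong] = haar_sets[OF m]
  have "(LINT z|m. f z) = (LINT z|distr m m ((+) y). f z)" by (simp add: haar_distr[OF m])
  also have "\<dots> = (LINT z|m. f (y + z))"
    using f by (subst integral_distr) auto
  finally show ?thesis by simp
qed

section \<open>Groups in which points are null\<close>

text \<open>
  At points where the convolution integrand is not integrable, the convolution has the default value
  \<open>0\<close>, so the bound holds everywhere.
\<close>

lemma norm_convolution_le:
  fixes a x :: "'g::group_add \<Rightarrow> complex"
  shows "ennreal (norm (convolution m a x z)) \<le> (\<integral>\<^sup>+y. ennreal (norm (a y)) * ennreal (norm (x (- y + z))) \<partial>m)"
proof (cases "integrable m (\<lambda>y. a y * x (- y + z))")
  case True
  then show ?thesis using integral_norm_bound_ennreal[OF True]
    by (simp add: convolution_def norm_mult ennreal_mult)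
next
  case False
  then show ?thesis by (simp add: convolution_def not_integrable_integral_eq)
qed

text \<open>
  This is for a \<open>G\<close> that is itself an integral, of a function measurable only for the Borel sets of the
  product space, so that \<open>G\<close> is not known to be measurable. One inequality survives, because the simple
  functions below \<open>indicator A * G\<close> are measurable and vanish outside \<open>A\<close>.
\<close>

lemma nn_integral_indicator_le_density:
  assumes A: "A \<in> sets M"
  shows "(\<integral>\<^sup>+x. indicator A x * G x \<partial>M) \<le> (\<integral>\<^sup>+x. G x \<partial>density M (indicator A))"
  unfolding nn_integral_def[of M]
proof (intro SUP_least)
  fix s assume s: "s \<in> {g. simple_function M g \<and> g \<le> (\<lambda>x. indicator A x * G x)}"
  then have [measurable]: "s \<in> borel_measurable M" by (auto intro: borel_measurable_simple_function)
  have le: "s x \<le> indicator A x * G x" for x using s by (auto simp: le_fun_def)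
  have "integral\<^sup>S M s = (\<integral>\<^sup>+x. s x \<partial>M)" using s by (simp add: nn_integral_eq_simple_integral)
  also have "\<dots> \<le> (\<integral>\<^sup>+x. indicator A x * s x \<partial>M)"
  proof (intro nn_integral_mono)
    fix x show "s x \<le> indicator A x * s x" using le[of x] by (auto split: split_indicator)
  qed
  also have "\<dots> = (\<integral>\<^sup>+x. s x \<partial>density M (indicator A))"
    using A by (subst nn_integral_density) auto
  also have "\<dots> \<le> (\<integral>\<^sup>+x. G x \<partial>density M (indicator A))"
  proof (intro nn_integral_mono)
    fix x show "s x \<le> G x" using le[of x] by (auto split: split_indicator_asm)
  qed
  finally show "integral\<^sup>S M s \<le> (\<integral>\<^sup>+x. G x \<partial>density M (indicator A))" .
qed

text \<open>
  By Tonelli, \<open>\<integral>\<^bsub>E\<^esub> \<bar>a * x\<bar>\<close> is at most the integral of \<open>\<bar>a(y)\<bar> \<integral>\<^bsub>E\<^esub> \<bar>x(- y + z)\<bar> dz\<close>, and left invariance turns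
  the inner integral into one of \<open>\<bar>x\<bar>\<close> over \<open>- y + E\<close>. Both measures in play, \<open>\<bar>a\<bar> m\<close> and \<open>m\<close> restricted
  to \<open>E\<close>, are tight.
\<close>

lemma convolution_test_bound_indicator:
  fixes m :: "'g::{topological_group_add,t2_space} measure"
  assumes m: "left_haar_measure m"
    and E: "E \<in> sets borel" "emeasure m E < \<infinity>"
    and x: "integrable m x"
    and \<eta>: "0 \<le> \<eta>"
    and small: "\<And>y. (\<integral>\<^sup>+w. ennreal (norm (x w)) * indicator E (y + w) \<partial>m) \<le> ennreal \<eta>"
  shows "test_bound m (indicator E) \<eta> x"
  unfolding test_bound_def
proof (intro conjI allI impI)
  note [simp, measurable_cong] = haar_sets[OF m]
  note [measurable] = E(1)
  have [measurable]: "x \<in> borel_measurable borel" using borel_measurable_integrable[OF x] by simp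
  have "ennreal (norm (LINT z|m. indicator E z *\<^sub>R x z)) \<le> (\<integral>\<^sup>+z. norm (indicator E z *\<^sub>R x z) \<partial>m)"
    using x by (intro integral_norm_bound_ennreal integrable_bounded_scaleR) (auto split: split_indicator)
  also have "\<dots> = (\<integral>\<^sup>+w. ennreal (norm (x w)) * indicator E (0 + w) \<partial>m)"
    by (intro nn_integral_cong) (auto split: split_indicator)
  also have "\<dots> \<le> ennreal \<eta>" by (rule small)
  finally show "norm (LINT z|m. indicator E z *\<^sub>R x z) \<le> \<eta>" using \<eta> by simp
  fix a assume a: "integrable m a" and conv: "integrable m (convolution m a x)"
  have [measurable]: "a \<in> borel_measurable borel" using borel_measurable_integrable[OF a] by simp
  have ta: "tight (density m (\<lambda>y. ennreal (norm (a y))))"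
    using a by (intro tight_density[OF m]) (auto simp: integrable_iff_bounded)
  have tE: "tight (density m (indicator E))"
    using E by (intro tight_density[OF m]) auto
  have k: "(\<lambda>p. ennreal (norm (x (- fst p + snd p)))) \<in> borel_measurable borel"
  proof -
    have "(\<lambda>p::'g \<times> 'g. - fst p + snd p) \<in> borel_measurable borel"
      by (intro borel_measurable_continuous_onI continuous_intros)
    then show ?thesis by measurable
  qed
  have tonelli: "(\<integral>\<^sup>+y. \<integral>\<^sup>+z. ennreal (norm (x (- y + z))) \<partial>density m (indicator E) \<partial>density m (\<lambda>y. ennreal (norm (a y))))
    = (\<integral>\<^sup>+z. \<integral>\<^sup>+y. ennreal (norm (x (- y + z))) \<partial>density m (\<lambda>y. ennreal (norm (a y))) \<partial>density m (indicator E))"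
    using tight_Tonelli[OF ta tE k] by simp
  have slices: "(\<lambda>z. ennreal (norm (x (- y + z)))) \<in> borel_measurable m"
     "(\<lambda>y. ennreal (norm (x (- y + z)))) \<in> borel_measurable m" for y z
  proof -
    have "(\<lambda>z::'g. - y + z) \<in> borel_measurable borel" "(\<lambda>y::'g. - y + z) \<in> borel_measurable borel"
      by (intro borel_measurable_continuous_onI continuous_intros)+
    then show "(\<lambda>z. ennreal (norm (x (- y + z)))) \<in> borel_measurable m"
     "(\<lambda>y. ennreal (norm (x (- y + z)))) \<in> borel_measurable m" by measurable
  qed
  have "ennreal (norm (LINT z|m. indicator E z *\<^sub>R convolution m a x z))
      \<le> (\<integral>\<^sup>+z. norm (indicator E z *\<^sub>R convolution m a x z) \<partial>m)"
    using conv by (intro integral_norm_bound_ennreal integrable_bounded_scaleR) (auto split: split_indicator)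
  also have "\<dots> \<le> (\<integral>\<^sup>+z. indicator E z * (\<integral>\<^sup>+y. ennreal (norm (a y)) * ennreal (norm (x (- y + z))) \<partial>m) \<partial>m)"
    using norm_convolution_le by (intro nn_integral_mono) (auto split: split_indicator)
  also have "\<dots> \<le> (\<integral>\<^sup>+z. \<integral>\<^sup>+y. ennreal (norm (x (- y + z))) \<partial>density m (\<lambda>y. ennreal (norm (a y))) \<partial>density m (indicator E))"
  proof -
    have "(\<integral>\<^sup>+y. ennreal (norm (a y)) * ennreal (norm (x (- y + z))) \<partial>m) =
        (\<integral>\<^sup>+y. ennreal (norm (x (- y + z))) \<partial>density m (\<lambda>y. ennreal (norm (a y))))" for z
      using slices(2) by (subst nn_integral_density) auto
    then show ?thesis using E(1) by (simp add: nn_integral_indicator_le_density)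
  qed
  also have "\<dots> = (\<integral>\<^sup>+y. \<integral>\<^sup>+z. ennreal (norm (x (- y + z))) \<partial>density m (indicator E) \<partial>density m (\<lambda>y. ennreal (norm (a y))))"
    by (rule tonelli[symmetric])
  also have "\<dots> \<le> (\<integral>\<^sup>+y. ennreal \<eta> \<partial>density m (\<lambda>y. ennreal (norm (a y))))"
  proof (intro nn_integral_mono)
    fix y
    have "(\<integral>\<^sup>+z. ennreal (norm (x (- y + z))) \<partial>density m (indicator E))
      = (\<integral>\<^sup>+z. ennreal (norm (x (- y + z))) * indicator E (y + (- y + z)) \<partial>m)"
      using slices by (subst nn_integral_density) (auto simp: mult.commute add.assoc[symmetric])
    also have "\<dots> = (\<integral>\<^sup>+w. ennreal (norm (x w)) * indicator E (y + w) \<partial>m)"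
      by (rule haar_nn_integral_translate[OF m]) (use haar_translation_measurable[of y] in measurable)
    also have "\<dots> \<le> ennreal \<eta>" by (rule small)
    finally show "(\<integral>\<^sup>+z. ennreal (norm (x (- y + z))) \<partial>density m (indicator E)) \<le> ennreal \<eta>" .
  qed
  also have "\<dots> = ennreal \<eta> * (\<integral>\<^sup>+y. norm (a y) \<partial>m)"
    by (subst nn_integral_density) (auto simp: nn_integral_cmult mult.commute)
  also have "\<dots> = ennreal (\<eta> * (LINT y|m. norm (a y)))"
    using a \<eta> by (subst nn_integral_eq_integral) (auto simp: ennreal_mult)
  finally show "norm (LINT z|m. indicator E z *\<^sub>R convolution m a x z) \<le> \<eta> * (LINT y|m. norm (a y))"
    using \<eta> by simp
qed

text \<open>
  If \<open>U\<close> were null, then so would be every compact set, being covered by finitely many translates of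
  \<open>U\<close>, and by inner regularity the whole group.
\<close>

lemma haar_open_pos:
  fixes m :: "'g::{topological_group_add,t2_space} measure"
  assumes m: "left_haar_measure m" and U: "open U" "0 \<in> U"
  shows "emeasure m U \<noteq> 0"
proof
  note [simp, measurable_cong] = haar_sets[OF m]
  assume U0: "emeasure m U = 0"
  have op: "open ((+) x ` U)" for x
  proof -
    have "(+) x ` U = (+) (- x) -` U" by (force simp: image_iff add.assoc[symmetric])
    then show ?thesis using U(1) by (auto intro!: open_vimage continuous_intros)
  qed
  have "emeasure m K = 0" if K: "compact K" for K
  proof -
    obtain F where F: "F \<subseteq> K" "finite F" "K \<subseteq> (\<Union>x\<in>F. (+) x ` U)"
      by (rule compactE_image[OF K, of K "\<lambda>x. (+) x ` U"]) (use op U(2) in force)+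
    have "emeasure m K \<le> emeasure m (\<Union>x\<in>F. (+) x ` U)"
      using F op by (intro emeasure_mono) auto
    also have "\<dots> \<le> (\<Sum>x\<in>F. emeasure m ((+) x ` U))"
      using F op by (intro emeasure_subadditive_finite) auto
    also have "\<dots> = 0" using haar_translate[OF m] U0 U(1) by simp
    finally show ?thesis by simp
  qed
  then have "emeasure m UNIV = 0"
    using haar_inner[OF m, of UNIV] by (simp add: SUP_eq_const[of _ _ 0] ex_in_conv[symmetric] exI[of _ "{}"])
  then show False using haar_nonzero[OF m] by simp
qed

lemma haar_small_open:
  fixes m :: "'g::{topological_group_add,t2_space} measure"
  assumes m: "left_haar_measure m" and 0: "emeasure m {0} = 0" and e: "0 < (e::real)"
  shows "\<exists>U. open U \<and> 0 \<in> U \<and> emeasure m U < e"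
  using INF_approx_ennreal[OF e haar_outer[OF m, of "{0}"]] 0 by auto

text \<open>
  Absolute continuity of the integral gives \<open>\<integral>\<^bsub>- y + E\<^esub> \<bar>x\<bar> < \<eta>\<close> uniformly in \<open>y\<close>, since \<open>- y + E\<close> has the
  measure of \<open>E\<close>. The integrals depend only on the class of \<open>x\<close>, so \<open>d\<close> serves all representatives.
\<close>

lemma uniform_modulus:
  fixes m :: "'g::{topological_group_add,t2_space} measure"
  assumes m: "left_haar_measure m" and X: "X \<in> carrier (L1_algebra m)" and \<eta>: "0 < (\<eta>::real)"
  shows "\<exists>d::real>0. \<forall>E. E \<in> sets borel \<longrightarrow> emeasure m E < d \<longrightarrow> (\<forall>x\<in>X. test_bound m (indicator E) \<eta> x)"
proof -
  note [simp, measurable_cong] = haar_sets[OF m]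
  obtain x0 where x0: "integrable m x0" "X = L1_class m x0"
    using X by (auto simp: L1_algebra_def quotient_def L1_class_def)
  have [measurable]: "x0 \<in> borel_measurable borel" using borel_measurable_integrable[OF x0(1)] by simp
  have "(\<integral>\<^sup>+w. ennreal (norm (x0 w)) \<partial>m) < \<infinity>" using x0(1) by (simp add: integrable_iff_bounded)
  from nn_integral_absolutely_continuous[OF _ this \<eta>] obtain d :: real where d: "d > 0"
    "\<And>E. E \<in> sets m \<Longrightarrow> emeasure m E < d \<Longrightarrow> (\<integral>\<^sup>+w. ennreal (norm (x0 w)) * indicator E w \<partial>m) < \<eta>"
    by auto
  have "test_bound m (indicator E) \<eta> x" if E: "E \<in> sets borel" "emeasure m E < d" and x: "x \<in> X" for E x
  proof (rule convolution_test_bound_indicator[OF m E(1)])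
    show "emeasure m E < \<infinity>" using E(2) by (rule order_less_trans) simp
    have x': "integrable m x" "AE w in m. x0 w = x w" using x by (auto simp: x0 L1_class_iff)
    then show "integrable m x" by simp
    show "0 \<le> \<eta>" using \<eta> by simp
    fix y
    have eq: "(+) y -` E = (+) (- y) ` E" by (force simp: image_iff add.assoc[symmetric])
    have "(+) y -` E \<in> sets borel" 
      using measurable_sets[OF haar_translation_measurable E(1), of y] by simp
    moreover have "emeasure m ((+) y -` E) < d" unfolding eq haar_translate[OF m E(1)] by (rule E)
    ultimately have "(\<integral>\<^sup>+w. ennreal (norm (x0 w)) * indicator ((+) y -` E) w \<partial>m) < \<eta>" using d by simp
    moreover have "(\<integral>\<^sup>+w. ennreal (norm (x0 w)) * indicator ((+) y -` E) w \<partial>m) = (\<integral>\<^sup>+w. ennreal (norm (x w)) * indicator E (y + w) \<partial>m)"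
      using x'(2) by (intro nn_integral_cong_AE) (auto elim!: eventually_mono split: split_indicator)
    ultimately show "(\<integral>\<^sup>+w. ennreal (norm (x w)) * indicator E (y + w) \<partial>m) \<le> ennreal \<eta>" by simp
  qed
  then show ?thesis using d(1) by blast
qed

lemma uniform_modulus_list:
  fixes m :: "'g::{topological_group_add,t2_space} measure"
  assumes m: "left_haar_measure m" and Xs: "set Xs \<subseteq> carrier (L1_algebra m)" and \<eta>: "0 < (\<eta>::real)"
  shows "\<exists>d::real>0. \<forall>E. E \<in> sets borel \<longrightarrow> emeasure m E < d \<longrightarrow> (\<forall>X\<in>set Xs. \<forall>x\<in>X. test_bound m (indicator E) \<eta> x)"
  using Xs
proof (induction Xs)
  case Nil
  then show ?case by (auto intro: exI[of _ 1])
next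
  case (Cons X Xs)
  obtain d :: real where d: "d > 0" "\<And>E. E \<in> sets borel \<Longrightarrow> emeasure m E < d \<Longrightarrow> (\<forall>X\<in>set Xs. \<forall>x\<in>X. test_bound m (indicator E) \<eta> x)"
    using Cons by auto
  obtain d' :: real where d': "d' > 0" "\<And>E. E \<in> sets borel \<Longrightarrow> emeasure m E < d' \<Longrightarrow> (\<forall>x\<in>X. test_bound m (indicator E) \<eta> x)"
    using uniform_modulus[OF m _ \<eta>, of X] Cons.prems by auto
  show ?case
  proof (intro exI[of _ "min d d'"] conjI allI impI)
    fix E assume E: "E \<in> sets borel" "emeasure m E < ennreal (min d d')"
    have "emeasure m E < d" "emeasure m E < d'"
      using E(2) by (rule order_less_le_trans; intro ennreal_leI; simp)+
    then show "\<forall>X\<in>set (X # Xs). \<forall>x\<in>X. test_bound m (indicator E) \<eta> x"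
      using d(2) d'(2) E(1) by simp
  qed (use d d' in auto)
qed

text \<open>
  The function \<open>f\<close> is \<open>\<Sum>\<^sub>j 2\<^sup>-\<^sup>j / m(E\<^sub>j)\<close> times the indicator of \<open>E\<^sub>j\<close>, corrected to integral zero on a set \<open>F\<close>
  that is disjoint from all the \<open>E\<^sub>j\<close>. On \<open>E\<^sub>k\<close> it is at least its \<open>k\<close>-th term, whose integral is \<open>2\<^sup>-\<^sup>k\<close>.
\<close>

lemma nonatomic_not_finitely_generated:
  fixes m :: "'g::{topological_group_add,t2_space} measure"
  assumes m: "left_haar_measure m" and 0: "emeasure m {0} = 0"
  shows "\<not> finitely_generated_left_ideal (L1_algebra m) (augmentation_ideal m)"
proof
  note [simp, measurable_cong] = haar_sets[OF m]
  assume "finitely_generated_left_ideal (L1_algebra m) (augmentation_ideal m)"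
  then obtain Xs where Xs: "set Xs \<subseteq> carrier (L1_algebra m)"
    "augmentation_ideal m = foldr (sum_sets (L1_algebra m)) (map (left_multiples (L1_algebra m)) Xs) {azero (L1_algebra m)}"
    unfolding finitely_generated_left_ideal_def by blast
  have "\<exists>K. compact K \<and> emeasure m K \<noteq> 0"
  proof (rule ccontr)
    assume "\<not> ?thesis"
    then have "emeasure m UNIV = 0"
      unfolding haar_inner[OF m open_UNIV] by (auto intro!: antisym SUP_least)
    then show False using haar_nonzero[OF m] by simp
  qed
  then obtain K where K: "compact K" "emeasure m K \<noteq> 0" by blast
  have Kfin: "emeasure m K < \<infinity>" by (rule haar_compact_finite[OF m K(1)])
  have [measurable]: "K \<in> sets borel" using K compact_imp_closed by (auto intro!: borel_closed)
  have Kpos: "0 < measure m K" using K Kfin by (simp add: measure_def enn2real_positive_iff zero_less_iff_neq_zero)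
  \<comment> \<open>All the \<open>E k\<close> will lie in \<open>U\<close>, and \<open>K - U\<close> is left for the correction.\<close>
  obtain U where U: "open U" "0 \<in> U" "emeasure m U < measure m K"
    using haar_small_open[OF m 0 Kpos] by blast
  define F where "F = K - U"
  have [measurable]: "U \<in> sets borel" "F \<in> sets borel" using U by (auto simp: F_def)
  have Ffin: "emeasure m F < \<infinity>"
    using Kfin by (rule le_less_trans[rotated]) (auto simp: F_def intro!: emeasure_mono)
  have "emeasure m F \<noteq> 0"
  proof
    assume "emeasure m F = 0"
    have "emeasure m K \<le> emeasure m (F \<union> U)" by (intro emeasure_mono) (auto simp: F_def)
    also have "\<dots> \<le> emeasure m F + emeasure m U" by (intro emeasure_subadditive) auto
    also have "\<dots> < emeasure m K" using U(3) Kfin \<open>emeasure m F = 0\<close> by (simp add: emeasure_eq_ennreal_measure less_top)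
    finally show False by simp
  qed
  then have Fpos: "0 < measure m F" using Ffin by (simp add: measure_def enn2real_positive_iff zero_less_iff_neq_zero)
  have "\<exists>E. open E \<and> 0 \<in> E \<and> E \<subseteq> U \<and> (\<forall>X\<in>set Xs. \<forall>x\<in>X. test_bound m (indicator E) ((1/4)^k) x)" for k :: nat
  proof -
    obtain d :: real where d: "d > 0" "\<And>E. E \<in> sets borel \<Longrightarrow> emeasure m E < d \<Longrightarrow> (\<forall>X\<in>set Xs. \<forall>x\<in>X. test_bound m (indicator E) ((1/4)^k) x)"
      using uniform_modulus_list[OF m Xs(1), of "(1/4)^k"] by auto
    obtain V where V: "open V" "0 \<in> V" "emeasure m V < d" using haar_small_open[OF m 0 d(1)] by blast
    have "emeasure m (V \<inter> U) < d" using V U by (intro le_less_trans[OF emeasure_mono V(3)]) auto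
    then show ?thesis using V U d(2)[of "V \<inter> U"] by (intro exI[of _ "V \<inter> U"]) auto
  qed
  then obtain E where E: "\<And>k::nat. open (E k)" "\<And>k. 0 \<in> E k" "\<And>k. E k \<subseteq> U"
    "\<And>k X x. X \<in> set Xs \<Longrightarrow> x \<in> X \<Longrightarrow> test_bound m (indicator (E k)) ((1/4)^k) x" by metis
  have [measurable]: "E k \<in> sets borel" for k using E by auto
  have Efin: "emeasure m (E k) < \<infinity>" for k
    using E(3)[of k] by (intro le_less_trans[OF emeasure_mono order_less_trans[OF U(3)]]) auto
  have Epos: "0 < measure m (E k)" for k
    using haar_open_pos[OF m E(1,2)[of k]] Efin[of k] by (simp add: measure_def enn2real_positive_iff zero_less_iff_neq_zero)
  \<comment> \<open>The series may diverge on the null set \<open>\<Inter>k. E k\<close>; extended values avoid this exceptional set.\<close>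
  define h :: "'g \<Rightarrow> ennreal" where "h z = (\<Sum>k. ennreal ((1/2)^k / measure m (E k)) * indicator (E k) z)" for z
  have hm[measurable]: "h \<in> borel_measurable borel" unfolding h_def by measurable
  have bump: "(\<integral>\<^sup>+z. ennreal ((1/2)^k / measure m (E k)) * indicator (E k) z \<partial>m) = ennreal ((1/2)^k)" for k
  proof -
    have "emeasure m (E k) = ennreal (measure m (E k))" using Efin[of k] by (simp add: emeasure_eq_ennreal_measure less_top)
    then show ?thesis using Epos[of k] by (simp add: nn_integral_cmult_indicator ennreal_mult[symmetric])
  qed
  have hfin: "(\<integral>\<^sup>+z. h z \<partial>m) < \<infinity>"
  proof -
    have "(\<integral>\<^sup>+z. h z \<partial>m) = (\<Sum>k. ennreal ((1/2)^k))"
      unfolding h_def by (subst nn_integral_suminf) (auto simp: bump)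
    also have "\<dots> = ennreal (\<Sum>k. (1/2)^k)"
      by (intro suminf_ennreal2) (auto intro: summable_geometric)
    finally show ?thesis by simp
  qed
  define g where "g z = enn2real (h z)" for z
  have gm[measurable]: "g \<in> borel_measurable borel" unfolding g_def by measurable
  have "AE z in m. h z \<noteq> \<infinity>" using hfin by (intro nn_integral_PInf_AE) auto
  then have gh: "AE z in m. ennreal (g z) = h z"
    by (rule eventually_mono) (simp add: g_def less_top)
  have gint: "integrable m g"
    using hfin by (intro integrableI_nonneg) (auto simp: g_def[symmetric] nn_integral_cong_AE[OF gh], simp add: g_def)
  define \<alpha> where "\<alpha> = (LINT z|m. g z) / measure m F"
  have Find: "integrable m (\<lambda>z. \<alpha> * indicator F z :: real)" using Ffin by (intro integrable_mult_right) auto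
  define f where "f z = complex_of_real (g z - \<alpha> * indicator F z)" for z
  have fint: "integrable m f" unfolding f_def using gint Find by auto
  have f0: "(LINT z|m. f z) = 0"
    unfolding f_def integral_complex_of_real using gint Find Fpos
    by (subst Bochner_Integration.integral_diff) (auto simp: \<alpha>_def)
  have large: "1 * (1/2)^k \<le> norm (LINT z|m. indicator (E k) z *\<^sub>R f z)" for k
  proof -
    have *: "indicator (E k) z *\<^sub>R f z = complex_of_real (indicator (E k) z * g z)" for z
      using E(3)[of k] by (auto simp: f_def F_def split: split_indicator)
    have int: "integrable m (\<lambda>z. indicator (E k) z * g z)"
      using integrable_mult_indicator[OF _ gint, of "E k"] by simp
    have "ennreal ((1/2)^k) \<le> (\<integral>\<^sup>+z. indicator (E k) z * h z \<partial>m)"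
      unfolding bump[symmetric]
    proof (intro nn_integral_mono)
      fix z
      have "(\<Sum>i\<in>{k}. ennreal ((1/2)^i / measure m (E i)) * indicator (E i) z) \<le> h z"
        unfolding h_def by (rule sum_le_suminf) auto
      then have "ennreal ((1/2)^k / measure m (E k)) * indicator (E k) z \<le> h z"
        by (simp only: sum.insert sum.empty finite.emptyI empty_iff not_False_eq_True add_0_right)
      then show "ennreal ((1/2)^k / measure m (E k)) * indicator (E k) z \<le> indicator (E k) z * h z"
        by (auto split: split_indicator_asm)
    qed
    also have "\<dots> = (\<integral>\<^sup>+z. ennreal (indicator (E k) z * g z) \<partial>m)"
      using gh by (intro nn_integral_cong_AE) (auto elim!: eventually_mono split: split_indicator)
    also have "\<dots> = ennreal (LINT z|m. indicator (E k) z * g z)"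
      using int by (intro nn_integral_eq_integral) (auto simp: g_def)
    finally have "(1/2)^k \<le> (LINT z|m. indicator (E k) z * g z)"
      using zero_less_power[of "1/2::real" k] unfolding ennreal_le_iff2 by linarith
    then show ?thesis unfolding * integral_complex_of_real by simp
  qed
  have "L1_class m f \<in> augmentation_ideal m" using fint f0 by (auto simp: augmentation_ideal_def)
  then show False
    using test_sequence_contradiction[of m f Xs "\<lambda>k. indicator (E k)" 1] Xs(2) E(4) large
    by (auto split: split_indicator)
qed

section \<open>Groups in which points have positive mass\<close>

text \<open>
  By invariance all points have the same positive mass, so almost everywhere means everywhere and each
  class in \<open>L\<^sup>1\<close> is a singleton, which reduces the algebra to computations with functions.
\<close>

locale atomic_haar =
  fixes m :: "'g::{topological_group_add,t2_space} measure"
  assumes haar: "left_haar_measure m" and atom: "emeasure m {0} \<noteq> 0"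
begin

lemmas [simp, measurable_cong] = haar_sets[OF haar]

definition atom_mass :: real where "atom_mass = measure m {0}"

lemma emeasure_point: "emeasure m {x} = ennreal atom_mass"
proof -
  have "emeasure m {x} = emeasure m {0}" using haar_translate[OF haar, of "{0}" x] by simp
  also have "\<dots> = ennreal atom_mass"
    unfolding atom_mass_def using haar_compact_finite[OF haar, of "{0}"]
    by (intro emeasure_eq_ennreal_measure) auto
  finally show ?thesis .
qed

lemma atom_mass_pos: "0 < atom_mass"
  using emeasure_point[of 0] atom by (metis ennreal_eq_0_iff linorder_not_less)

lemma AE_iff: "(AE x in m. P x) \<longleftrightarrow> (\<forall>x. P x)"
proof
  assume "AE x in m. P x"
  then obtain N where N: "{x \<in> space m. \<not> P x} \<subseteq> N" "emeasure m N = 0" "N \<in> sets m" by (rule AE_E)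
  show "\<forall>x. P x"
  proof (rule ccontr)
    assume "\<not> ?thesis"
    then obtain x where "x \<in> N" using N(1) by auto
    then have "emeasure m {x} \<le> emeasure m N" using N by (intro emeasure_mono) auto
    then show False using N(2) emeasure_point[of x] atom_mass_pos by simp
  qed
qed simp

lemma L1_class_singleton: "L1_class m f = (if integrable m f then {f} else {})"
  by (auto simp: L1_class_iff AE_iff fun_eq_iff[symmetric])

lemma carrier_iff: "F \<in> carrier (L1_algebra m) \<longleftrightarrow> (\<exists>f. integrable m f \<and> F = {f})"
  by (auto simp: L1_algebra_def quotient_def L1_class_def[symmetric] L1_class_singleton)

lemma augmentation_iff: "F \<in> augmentation_ideal m \<longleftrightarrow> (\<exists>f. integrable m f \<and> (LINT x|m. f x) = 0 \<and> F = {f})"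
  by (auto simp: augmentation_ideal_def L1_class_singleton)

lemma singleton_operations:
  "azero (L1_algebra m) = {\<lambda>x. 0}"
  "aadd (L1_algebra m) {f} {g} = L1_class m (\<lambda>x. f x + g x)"
  "ascale (L1_algebra m) s {f} = L1_class m (\<lambda>x. s * f x)"
  "amult (L1_algebra m) {f} {g} = L1_class m (convolution m f g)"
  by (simp_all add: L1_algebra_def L1_class_singleton)

text \<open>
  A compact set has finite measure, and \<open>n\<close> points have \<open>n\<close> times the mass of one.
\<close>

lemma compact_finite:
  fixes K :: "'g set"
  assumes K: "compact K" shows "finite K"
proof (rule ccontr)
  assume inf: "infinite K"
  have Kfin: "emeasure m K < \<infinity>" by (rule haar_compact_finite[OF haar K])
  have Kb: "K \<in> sets borel" using K compact_imp_closed by (intro borel_closed) blast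
  have "n * atom_mass \<le> measure m K" for n :: nat
  proof -
    obtain F where F: "F \<subseteq> K" "finite F" "card F = n" using infinite_arbitrarily_large[OF inf] by blast
    have "(\<Sum>x\<in>F. emeasure m {x}) = emeasure m F" using F by (subst emeasure_eq_sum_singleton) auto
    also have "\<dots> \<le> emeasure m K" using F Kb by (intro emeasure_mono) auto
    finally have "ennreal (n * atom_mass) \<le> ennreal (measure m K)"
      using F(3) atom_mass_pos Kfin by (simp add: emeasure_point emeasure_eq_ennreal_measure less_top ennreal_mult' ennreal_of_nat_eq_real_of_nat)
    then show ?thesis using atom_mass_pos by (simp add: ennreal_le_iff)
  qed
  moreover obtain n :: nat where "measure m K < n * atom_mass" using reals_Archimedean3[OF atom_mass_pos] by blast
  ultimately show False by (meson linorder_not_less)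
qed

lemma integral_finite_support:
  fixes \<phi> :: "'g \<Rightarrow> real" and h :: "'g \<Rightarrow> complex"
  assumes S: "finite S" "\<And>z. z \<notin> S \<Longrightarrow> \<phi> z = 0"
  shows "integrable m (\<lambda>z. \<phi> z *\<^sub>R h z)" "(LINT z|m. \<phi> z *\<^sub>R h z) = (\<Sum>s\<in>S. atom_mass *\<^sub>R \<phi> s *\<^sub>R h s)"
proof -
  have eq: "\<phi> z *\<^sub>R h z = (\<Sum>s\<in>S. indicator {s} z *\<^sub>R (\<phi> s *\<^sub>R h s))" for z
  proof (cases "z \<in> S")
    case True
    have "(\<Sum>s\<in>S. indicator {s} z *\<^sub>R (\<phi> s *\<^sub>R h s)) = (\<Sum>s\<in>{z}. indicator {s} z *\<^sub>R (\<phi> s *\<^sub>R h s))"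
      using S True by (intro sum.mono_neutral_right) auto
    then show ?thesis by simp
  next
    case False
    then have "(\<Sum>s\<in>S. indicator {s} z *\<^sub>R (\<phi> s *\<^sub>R h s)) = 0"
      by (intro sum.neutral) (auto split: split_indicator)
    then show ?thesis using S(2)[OF False] by (simp only: scaleR_zero_left)
  qed
  have int: "integrable m (\<lambda>z. indicator {s} z *\<^sub>R (\<phi> s *\<^sub>R h s))" for s
    using emeasure_point[of s] by (intro integrable_scaleR_left integrable_real_indicator) auto
  have eq': "(\<lambda>z. \<phi> z *\<^sub>R h z) = (\<lambda>z. \<Sum>s\<in>S. indicator {s} z *\<^sub>R (\<phi> s *\<^sub>R h s))"
    by (rule ext) (rule eq)
  show "integrable m (\<lambda>z. \<phi> z *\<^sub>R h z)"
    by (subst eq') (intro Bochner_Integration.integrable_sum int)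
  have "(LINT z|m. indicator {s} z *\<^sub>R (\<phi> s *\<^sub>R h s)) = atom_mass *\<^sub>R \<phi> s *\<^sub>R h s" for s
    using emeasure_point[of s] atom_mass_pos by (simp add: measure_def)
  then show "(LINT z|m. \<phi> z *\<^sub>R h z) = (\<Sum>s\<in>S. atom_mass *\<^sub>R \<phi> s *\<^sub>R h s)"
    by (subst eq', subst Bochner_Integration.integral_sum[OF int]) simp
qed

definition unit_elt :: "'g \<Rightarrow> complex" where "unit_elt z = (if z = 0 then complex_of_real (1 / atom_mass) else 0)"

lemma unit_elt:
  "integrable m unit_elt" "(LINT z|m. unit_elt z) = 1"
  "convolution m unit_elt f = f" "convolution m f unit_elt = f"
proof -
  have eq: "unit_elt z = (indicator {0} z :: real) *\<^sub>R complex_of_real (1 / atom_mass)" for z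
    by (simp add: unit_elt_def)
  show "integrable m unit_elt" "(LINT z|m. unit_elt z) = 1"
    unfolding eq using integral_finite_support[of "{0}" "indicator {0}" "\<lambda>z. complex_of_real (1 / atom_mass)"] atom_mass_pos
    by (auto simp: scaleR_conv_of_real)
  show "convolution m unit_elt f = f"
  proof
    fix z
    have "convolution m unit_elt f z = (LINT y|m. (indicator {0} y :: real) *\<^sub>R (complex_of_real (1 / atom_mass) * f (- y + z)))"
      unfolding convolution_def eq by (intro Bochner_Integration.integral_cong) auto
    also have "\<dots> = f z"
      using atom_mass_pos by (subst integral_finite_support[of "{0}"]) (auto simp: scaleR_conv_of_real)
    finally show "convolution m unit_elt f z = f z" .
  qed
  show "convolution m f unit_elt = f"
  proof
    fix z
    have "(- y + z = 0) = (y = z)" for y :: 'g using eq_neg_iff_add_eq_0[of "- y" z] by simp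
    then have "convolution m f unit_elt z = (LINT y|m. (indicator {z} y :: real) *\<^sub>R (f y * complex_of_real (1 / atom_mass)))"
      unfolding convolution_def unit_elt_def by (intro Bochner_Integration.integral_cong) auto
    also have "\<dots> = f z"
      using atom_mass_pos by (subst integral_finite_support[of "{z}"]) (auto simp: scaleR_conv_of_real)
    finally show "convolution m f unit_elt z = f z" .
  qed
qed

lemma convolution_zero_left: "convolution m (\<lambda>x. 0) f = (\<lambda>x. 0)"
  by (simp add: convolution_def fun_eq_iff)

lemma left_multiples_member:
  assumes "integrable m x" "integrable m u" "integrable m (convolution m u x)"
  shows "{convolution m u x} \<in> left_multiples (L1_algebra m) {x}"
  unfolding left_multiples_def
proof (intro CollectI conjI bexI[of _ "({u}, 0)"])
  show "{convolution m u x} \<in> carrier (L1_algebra m)" using assms by (auto simp: carrier_iff)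
  show "({u}, 0) \<in> carrier (cond_unitisation (L1_algebra m))"
    using assms by (auto simp: cond_unitisation_def unitisation_def carrier_iff)
  show "amult (cond_unitisation (L1_algebra m)) ({u}, 0) ({x}, 0) = ({convolution m u x}, 0)"
    using assms by (auto simp: cond_unitisation_def unitisation_def singleton_operations L1_class_singleton)
qed

text \<open>
  The estimate for hat functions needs generators of integral zero, so the generators must
  lie in the ideal. This uses the identity of the algebra and zero multiples of the other generators.
\<close>

lemma generator_in_ideal:
  assumes Xs: "set Xs \<subseteq> carrier (L1_algebra m)" and X: "X \<in> set Xs"
  shows "X \<in> foldr (sum_sets (L1_algebra m)) (map (left_multiples (L1_algebra m)) Xs) {azero (L1_algebra m)}"
proof -
  have zero: "{\<lambda>x. 0} \<in> left_multiples (L1_algebra m) Y" and self: "Y \<in> left_multiples (L1_algebra m) Y"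
    if Y: "Y \<in> carrier (L1_algebra m)" for Y
  proof -
    obtain y where y: "integrable m y" "Y = {y}" using Y carrier_iff by blast
    show "{\<lambda>x. 0} \<in> left_multiples (L1_algebra m) Y"
      using left_multiples_member[OF y(1), of "\<lambda>x. 0"] by (simp add: convolution_zero_left y)
    show "Y \<in> left_multiples (L1_algebra m) Y"
      using left_multiples_member[OF y(1) unit_elt(1)] y by (simp add: unit_elt)
  qed
  have zeros: "set Ys \<subseteq> carrier (L1_algebra m) \<Longrightarrow>
    {\<lambda>x. 0} \<in> foldr (sum_sets (L1_algebra m)) (map (left_multiples (L1_algebra m)) Ys) {azero (L1_algebra m)}" for Ys
  proof (induction Ys)
    case (Cons Y Ys)
    have "aadd (L1_algebra m) {\<lambda>x. 0} {\<lambda>x. 0} = {\<lambda>x. 0}" by (simp add: singleton_operations L1_class_singleton)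
    then show ?case
      using zero[of Y] Cons unfolding sum_sets_def[of _ "left_multiples _ Y"] list.map foldr_Cons o_apply
      by fastforce
  qed (simp add: singleton_operations)
  show ?thesis using Xs X
  proof (induction Xs)
    case (Cons Y Ys)
    obtain x where x: "integrable m x" "X = {x}" using Cons.prems carrier_iff by blast
    consider "X = Y" | "X \<in> set Ys" using Cons.prems by auto
    then show ?case
    proof cases
      case 1
      have "aadd (L1_algebra m) X {\<lambda>x. 0} = X" using x by (simp add: singleton_operations L1_class_singleton)
      then show ?thesis
        using self[of Y] zeros[of Ys] Cons.prems 1 unfolding sum_sets_def[of _ "left_multiples _ Y"] list.map foldr_Cons o_apply
        by fastforce
    next
      case 2
      have "aadd (L1_algebra m) {\<lambda>x. 0} X = X" using x by (simp add: singleton_operations L1_class_singleton)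
      then show ?thesis
        using zero[of Y] Cons.IH 2 Cons.prems unfolding sum_sets_def[of _ "left_multiples _ Y"] list.map foldr_Cons o_apply
        by fastforce
    qed
  qed simp
qed

section \<open>Finite groups\<close>

text \<open>
  With \<open>\<kappa> = 1 / m(G)\<close> the convolution of \<open>f\<close> and the constant \<open>\<kappa>\<close> is \<open>\<kappa> \<integral> f\<close>, so \<open>e = \<delta> - \<kappa>\<close> satisfies
  \<open>f * e = f\<close> when \<open>\<integral> f = 0\<close>. Conversely \<open>\<integral> e = 0\<close>, and integration is multiplicative for convolution.
\<close>

lemma augmentation_ideal_principal:
  assumes fin: "finite (UNIV :: 'g set)"
  shows "finitely_generated_left_ideal (L1_algebra m) (augmentation_ideal m)"
proof -
  have bor: "f \<in> borel_measurable borel" for f :: "'g \<Rightarrow> complex"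
  proof -
    have "A \<in> sets borel" for A :: "'g set"
      using finite_subset[OF subset_UNIV fin] by (intro borel_closed finite_imp_closed)
    then show ?thesis by (auto simp: measurable_def)
  qed
  have sum: "integrable m f" "(LINT z|m. f z) = (\<Sum>z\<in>UNIV. atom_mass *\<^sub>R f z)" for f :: "'g \<Rightarrow> complex"
    using integral_finite_support[OF fin, of "\<lambda>z. 1" f] by auto
  have trans: "(\<Sum>z\<in>UNIV. f (- y + z)) = (\<Sum>z\<in>UNIV. f z)" for f :: "'g \<Rightarrow> complex" and y
    using sum(2)[of "\<lambda>z. f (- y + z)"] sum(2)[of f] haar_integral_translate[OF haar bor, of f "- y"] atom_mass_pos
    by (simp flip: scaleR_right.sum)
  define \<kappa> :: complex where "\<kappa> = 1 / (of_real atom_mass * of_nat (card (UNIV :: 'g set)))"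
  have \<kappa>: "(LINT z|m. \<kappa>) = 1"
    unfolding sum(2) using atom_mass_pos finite_UNIV_card_ge_0[OF fin] by (simp add: \<kappa>_def scaleR_conv_of_real)
  define e where "e z = unit_elt z - \<kappa>" for z
  have conv: "(LINT z|m. convolution m f g z) = (LINT z|m. f z) * (LINT z|m. g z)" for f g
  proof -
    have "(LINT z|m. convolution m f g z) = (\<Sum>z\<in>UNIV. atom_mass *\<^sub>R (\<Sum>y\<in>UNIV. atom_mass *\<^sub>R (f y * g (- y + z))))"
      unfolding convolution_def sum(2) ..
    also have "\<dots> = atom_mass *\<^sub>R atom_mass *\<^sub>R (\<Sum>y\<in>UNIV. \<Sum>z\<in>UNIV. f y * g (- y + z))"
      by (subst sum.swap) (simp add: scaleR_right.sum)
    also have "\<dots> = atom_mass *\<^sub>R atom_mass *\<^sub>R (\<Sum>y\<in>UNIV. f y * (\<Sum>z\<in>UNIV. g z))"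
      by (simp add: sum_distrib_left[symmetric] trans)
    also have "\<dots> = (LINT z|m. f z) * (LINT z|m. g z)"
      unfolding sum(2) by (simp add: scaleR_right.sum[symmetric] sum_distrib_right[symmetric])
    finally show ?thesis .
  qed
  have e0: "(LINT z|m. e z) = 0"
    unfolding e_def Bochner_Integration.integral_diff[OF sum(1) sum(1)] unit_elt(2) \<kappa> by simp
  have fe: "convolution m f e = f" if "(LINT z|m. f z) = 0" for f
  proof
    fix z
    have "convolution m f e z = (LINT y|m. f y * unit_elt (- y + z) - f y * \<kappa>)"
      unfolding convolution_def e_def by (simp add: algebra_simps)
    also have "\<dots> = convolution m f unit_elt z - (LINT y|m. f y) * \<kappa>"
      unfolding convolution_def using sum(1) by (subst Bochner_Integration.integral_diff) auto
    finally show "convolution m f e z = f z" using that by (simp add: unit_elt)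
  qed
  let ?A = "L1_algebra m"
  have L1: "L1_class m f = {f}" for f by (simp add: L1_class_singleton sum)
  have carr: "F \<in> carrier ?A \<longleftrightarrow> (\<exists>f. F = {f})" for F by (simp add: carrier_iff sum)
  have aug: "F \<in> augmentation_ideal m \<longleftrightarrow> (\<exists>f. (LINT x|m. f x) = 0 \<and> F = {f})" for F
    by (simp add: augmentation_iff sum(1))
  have int_add: "(LINT x|m. f x + g x) = (LINT x|m. f x) + (LINT x|m. g x)" for f g :: "'g \<Rightarrow> complex"
    by (intro Bochner_Integration.integral_add sum)
  have "left_ideal ?A (augmentation_ideal m)"
    unfolding left_ideal_def
    by (auto simp: aug carr singleton_operations L1 int_add conv)
  moreover have "left_multiples ?A {e} = augmentation_ideal m"
  proof (intro Set.set_eqI iffI)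
    fix F assume "F \<in> augmentation_ideal m"
    then obtain f where f: "(LINT x|m. f x) = 0" "F = {f}" by (auto simp: aug)
    then show "F \<in> left_multiples ?A {e}"
      using left_multiples_member[OF sum(1)[of e] sum(1)[of f] sum(1)] by (simp add: fe)
  next
    fix F assume F: "F \<in> left_multiples ?A {e}"
    then obtain u s where u: "(u, s) \<in> carrier (cond_unitisation ?A)" "amult (cond_unitisation ?A) (u, s) ({e}, 0) = (F, 0)"
      by (auto simp: left_multiples_def)
    then obtain f where "u = {f}"
      by (auto simp: cond_unitisation_def unitisation_def carr split: if_splits)
    then have "F = {\<lambda>x. convolution m f e x + (s * e x + 0)}"
      using u(2) by (auto simp: cond_unitisation_def unitisation_def singleton_operations L1 split: if_splits)
    then show "F \<in> augmentation_ideal m" by (simp add: aug int_add conv e0)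
  qed
  moreover have "sum_sets ?A (augmentation_ideal m) {azero ?A} = augmentation_ideal m"
  proof -
    have "aadd ?A F (azero ?A) = F" if "F \<in> augmentation_ideal m" for F
      using that by (auto simp: aug singleton_operations L1)
    then show ?thesis by (force simp: sum_sets_def)
  qed
  ultimately show ?thesis
    unfolding finitely_generated_left_ideal_def
    by (intro conjI exI[of _ "[{e}]"]) (auto simp: carr)
qed

section \<open>Infinite groups in which points have positive mass\<close>

text \<open>
  Inner regularity of \<open>\<bar>x\<bar> m\<close> provides a compact set, and compact sets are finite here.
\<close>

lemma finite_tail:
  assumes x: "integrable m (x :: 'g \<Rightarrow> complex)" and e: "0 < (e::real)"
  shows "\<exists>K. finite K \<and> (LINT w|m. norm (x w) * indicator (- K) w) < e"
proof -
  have [measurable]: "x \<in> borel_measurable borel" using borel_measurable_integrable[OF x] by simp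
  have t: "tight (density m (\<lambda>w. ennreal (norm (x w))))"
    using x by (intro tight_density[OF haar]) (auto simp: integrable_iff_bounded)
  then obtain K where K: "compact K" "emeasure (density m (\<lambda>w. ennreal (norm (x w)))) (UNIV - K) < e"
    using e unfolding tight_def by (metis sets.top space_borel)
  have fin: "finite K" by (rule compact_finite[OF K(1)])
  have [measurable]: "K \<in> sets borel" using finite_imp_closed[OF fin] by (rule borel_closed)
  have int: "integrable m (\<lambda>w. norm (x w) * indicator (- K) w)"
    by (intro integrable_real_mult_indicator integrable_norm x) auto
  have "ennreal (LINT w|m. norm (x w) * indicator (- K) w) = (\<integral>\<^sup>+w. norm (x w) * indicator (- K) w \<partial>m)"
    using int by (intro nn_integral_eq_integral[symmetric]) auto
  also have "\<dots> = emeasure (density m (\<lambda>w. ennreal (norm (x w)))) (UNIV - K)"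
    by (subst emeasure_density) (auto simp: Compl_eq_Diff_UNIV ennreal_mult' intro!: nn_integral_cong split: split_indicator)
  also have "\<dots> < ennreal e" by (rule K)
  finally show ?thesis using fin e by (auto simp: ennreal_less_iff intro!: exI[of _ K])
qed

text \<open>
  Sums of exactly \<open>n\<close> elements of \<open>S\<close>. For a symmetric \<open>S\<close> that contains \<open>0\<close>, these are the balls of the word
  metric on the subgroup generated by \<open>S\<close>.
\<close>

primrec reach :: "'g set \<Rightarrow> nat \<Rightarrow> 'g set" where
  "reach S 0 = {0}"
| "reach S (Suc n) = (\<lambda>(z, w). z + w) ` (reach S n \<times> S)"

text \<open>
  Averaging the indicators of the first \<open>n\<close> balls gives \<open>max 0 (1 - \<bar>z\<bar> / n)\<close>, where \<open>\<bar>z\<bar>\<close> is the word length,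
  without defining the length, which is infinite outside the subgroup generated by \<open>S\<close>.
\<close>

definition hat :: "'g set \<Rightarrow> nat \<Rightarrow> 'g \<Rightarrow> real" where
  "hat S n z = card {j. j < n \<and> z \<in> reach S j} / n"

lemma hat_bounds: "0 \<le> hat S n z" "hat S n z \<le> 1"
proof -
  have "card {j. j < n \<and> z \<in> reach S j} \<le> card {..<n}" by (intro card_mono) auto
  then show "0 \<le> hat S n z" "hat S n z \<le> 1" by (auto simp: hat_def divide_le_eq_1)
qed

lemma hat_abs_le: "\<bar>hat S n z\<bar> \<le> 1"
  using hat_bounds[of S n z] by linarith

lemma hat_zero:
  assumes "0 \<in> S" "0 < n" shows "hat S n 0 = 1"
proof -
  have "0 \<in> reach S j" for j
    using assms(1) by (induction j) (auto intro!: image_eqI[of _ _ "(0, 0)"])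
  then have "{j. j < n \<and> 0 \<in> reach S j} = {..<n}" by auto
  then show ?thesis using assms(2) by (simp add: hat_def)
qed

lemma hat_support:
  assumes "finite S" shows "finite {z. hat S n z \<noteq> 0}"
proof (rule finite_subset)
  show "{z. hat S n z \<noteq> 0} \<subseteq> (\<Union>j<n. reach S j)" by (auto simp: hat_def card_gt_0_iff)
  have "finite (reach S j)" for j using assms by (induction j) auto
  then show "finite (\<Union>j<n. reach S j)" by simp
qed

text \<open>
  Translation by \<open>w \<in> S\<close> takes each ball into the next one, so at most one of the \<open>n\<close> memberships is
  lost.
\<close>

lemma hat_step_le:
  assumes "w \<in> S" shows "hat S n z \<le> hat S n (z + w) + 1 / n"
proof -
  have "Suc ` {j. j < n \<and> z \<in> reach S j} \<subseteq> insert n {j. j < n \<and> z + w \<in> reach S j}"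
    using assms by (auto intro!: image_eqI[of _ _ "(z, w)"])
  then have "card (Suc ` {j. j < n \<and> z \<in> reach S j}) \<le> card (insert n {j. j < n \<and> z + w \<in> reach S j})"
    by (intro card_mono) auto
  then have "card {j. j < n \<and> z \<in> reach S j} \<le> card {j. j < n \<and> z + w \<in> reach S j} + 1"
    by (simp add: card_image)
  then have "real (card {j. j < n \<and> z \<in> reach S j}) \<le> real (card {j. j < n \<and> z + w \<in> reach S j}) + 1"
    by linarith
  then show ?thesis unfolding hat_def by (simp add: add_divide_distrib[symmetric] divide_right_mono)
qed

lemma hat_step:
  assumes "w \<in> S" "- w \<in> S" shows "\<bar>hat S n (z + w) - hat S n z\<bar> \<le> 1 / n"
  using hat_step_le[OF assms(1), of n z] hat_step_le[OF assms(2), of n "z + w"]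
  by (simp add: add.assoc abs_le_iff)

lemma finite_support_measurable:
  fixes \<phi> :: "'g \<Rightarrow> real"
  assumes \<phi>: "finite {z. \<phi> z \<noteq> 0}"
  shows "\<phi> \<in> borel_measurable borel"
proof -
  define S where "S = {z. \<phi> z \<noteq> 0}"
  have S: "finite S" "\<And>z. z \<notin> S \<Longrightarrow> \<phi> z = 0" using \<phi> by (auto simp: S_def)
  have "\<phi> = (\<lambda>z. \<Sum>s\<in>S. \<phi> s * indicator {s} z)"
  proof
    fix z show "\<phi> z = (\<Sum>s\<in>S. \<phi> s * indicator {s} z)"
      using S by (cases "z \<in> S") (simp_all add: indicator_def if_distrib[of "\<lambda>t. _ * t"] sum.delta cong: if_cong)
  qed
  moreover have "(\<lambda>z. \<Sum>s\<in>S. \<phi> s * indicator {s} z :: real) \<in> borel_measurable borel"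
    by (intro borel_measurable_sum borel_measurable_times borel_measurable_indicator borel_closed) auto
  ultimately show ?thesis by metis
qed

text \<open>
  Since \<open>\<phi>\<close> has finite support, interchanging the integrals is interchanging an integral with a finite
  sum: \<open>\<integral> \<phi> (a * x)\<close> is the integral of \<open>a(y) \<integral> \<phi>(y + w) x(w) dw\<close>. The summands are integrable because
  \<open>x\<close> is bounded, points having positive mass.
\<close>

lemma convolution_test_bound_finite_support:
  assumes \<phi>: "finite {z. \<phi> z \<noteq> 0}"
    and x: "integrable m x" and \<eta>: "0 \<le> \<eta>"
    and small: "\<And>y. norm (LINT w|m. \<phi> (y + w) *\<^sub>R x w) \<le> \<eta>"
  shows "test_bound m \<phi> \<eta> x"
  unfolding test_bound_def
proof (intro conjI allI impI)
  show "norm (LINT z|m. \<phi> z *\<^sub>R x z) \<le> \<eta>" using small[of 0] by simp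
  fix a :: "'g \<Rightarrow> complex" assume a: "integrable m a"
  define S where "S = {z. \<phi> z \<noteq> 0}"
  have S: "finite S" "\<And>z. z \<notin> S \<Longrightarrow> \<phi> z = 0" using \<phi> by (auto simp: S_def)
  have xm[measurable]: "x \<in> borel_measurable borel" using borel_measurable_integrable[OF x] by simp
  have am[measurable]: "a \<in> borel_measurable borel" using borel_measurable_integrable[OF a] by simp
  note [measurable] = finite_support_measurable[OF \<phi>]
  have bound: "norm (x w) \<le> (LINT w|m. norm (x w)) / atom_mass" for w
  proof -
    have "atom_mass * norm (x w) = (LINT v|m. indicator {w} v * norm (x w))"
      using emeasure_point[of w] atom_mass_pos by (simp add: measure_def)
    also have "\<dots> \<le> (LINT v|m. norm (x v))"
      using x emeasure_point[of w]
      by (intro integral_mono) (auto split: split_indicator)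
    finally show ?thesis using atom_mass_pos by (simp add: field_simps)
  qed
  have int: "integrable m (\<lambda>y. a y * x (- y + z))" for z
  proof (rule Bochner_Integration.integrable_bound)
    show "integrable m (\<lambda>y. ((LINT w|m. norm (x w)) / atom_mass) *\<^sub>R a y)" using a by simp
    have "(\<lambda>y::'g. - y + z) \<in> borel_measurable borel"
      by (intro borel_measurable_continuous_onI continuous_intros)
    then show "(\<lambda>y. a y * x (- y + z)) \<in> borel_measurable m" by measurable
    have B: "0 \<le> (LINT w|m. norm (x w)) / atom_mass" using atom_mass_pos by simp
    show "AE y in m. norm (a y * x (- y + z)) \<le> norm (((LINT w|m. norm (x w)) / atom_mass) *\<^sub>R a y)"
    proof (rule AE_I2)
      fix y
      have "norm (a y) * norm (x (- y + z)) \<le> norm (a y) * ((LINT w|m. norm (x w)) / atom_mass)"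
        by (intro mult_left_mono bound) auto
      then show "norm (a y * x (- y + z)) \<le> norm (((LINT w|m. norm (x w)) / atom_mass) *\<^sub>R a y)"
        by (simp only: norm_mult norm_scaleR real_norm_def abs_of_nonneg[OF B] mult.commute)
    qed
  qed
  define H where "H y = (\<Sum>s\<in>S. atom_mass *\<^sub>R \<phi> s *\<^sub>R (a y * x (- y + s)))" for y
  have Hint: "integrable m H" unfolding H_def using int by auto
  have H: "H y = a y * (LINT w|m. \<phi> (y + w) *\<^sub>R x w)" for y
  proof -
    have "(LINT w|m. \<phi> (y + w) *\<^sub>R x w) = (LINT w|m. \<phi> (y + w) *\<^sub>R x (- y + (y + w)))"
      by (simp add: add.assoc[symmetric])
    also have "\<dots> = (LINT z|m. \<phi> z *\<^sub>R x (- y + z))"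
      using haar_translation_measurable[of "- y"]
      by (intro haar_integral_translate[OF haar, of "\<lambda>z. \<phi> z *\<^sub>R x (- y + z)"]) measurable
    also have "\<dots> = (\<Sum>s\<in>S. atom_mass *\<^sub>R \<phi> s *\<^sub>R x (- y + s))" by (rule integral_finite_support(2)[OF S])
    finally show "H y = a y * (LINT w|m. \<phi> (y + w) *\<^sub>R x w)"
      by (simp add: H_def sum_distrib_left)
  qed
  have "(LINT z|m. \<phi> z *\<^sub>R convolution m a x z) = (\<Sum>s\<in>S. atom_mass *\<^sub>R \<phi> s *\<^sub>R (LINT y|m. a y * x (- y + s)))"
    unfolding convolution_def by (rule integral_finite_support(2)[OF S])
  also have "\<dots> = (LINT y|m. H y)"
    unfolding H_def using int by (subst Bochner_Integration.integral_sum) auto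
  also have "norm \<dots> \<le> (LINT y|m. norm (H y))" by (rule integral_norm_bound)
  also have "\<dots> \<le> (LINT y|m. norm (a y) * \<eta>)"
  proof (rule integral_mono)
    show "norm (H y) \<le> norm (a y) * \<eta>" for y
      unfolding H norm_mult by (intro mult_left_mono small) auto
  qed (use Hint a in auto)
  also have "\<dots> = \<eta> * (LINT y|m. norm (a y))" by (simp add: mult.commute)
  finally show "norm (LINT z|m. \<phi> z *\<^sub>R convolution m a x z) \<le> \<eta> * (LINT y|m. norm (a y))" .
qed

text \<open>
  Because \<open>\<integral> x = 0\<close>, the value \<open>\<phi>(y + w)\<close> may be replaced by \<open>\<phi>(y + w) - \<phi>(y)\<close>, which is at most \<open>1 / n\<close> in modulus for
  \<open>w \<in> S\<close> and at most \<open>1\<close> elsewhere.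
\<close>

lemma hat_test_bound:
  assumes x: "integrable m x" "(LINT w|m. x w) = 0"
    and S: "finite S" "uminus ` S \<subseteq> S" and n: "0 < n"
    and tail: "(LINT w|m. norm (x w) * indicator (- S) w) \<le> \<eta> / 2"
    and long: "(LINT w|m. norm (x w)) / n \<le> \<eta> / 2"
  shows "test_bound m (hat S n) \<eta> x"
proof (rule convolution_test_bound_finite_support[OF hat_support[OF S(1)] x(1)])
  have [measurable]: "S \<in> sets borel" using finite_imp_closed[OF S(1)] by (rule borel_closed)
  have int: "integrable m (\<lambda>w. norm (x w) * indicator (- S) w)"
    by (intro integrable_real_mult_indicator integrable_norm x) auto
  have "0 \<le> (LINT w|m. norm (x w) * indicator (- S) w)" by (intro integral_nonneg_AE) auto
  then show "0 \<le> \<eta>" using tail by linarith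
  fix y
  have hm: "hat S n \<in> borel_measurable borel"
    by (rule finite_support_measurable[OF hat_support[OF S(1)]])
  have hy: "(\<lambda>w. hat S n (y + w)) \<in> borel_measurable m"
    using measurable_compose[OF haar_translation_measurable hm] by simp
  have iy: "integrable m (\<lambda>w. hat S n (y + w) *\<^sub>R x w)"
    by (intro integrable_bounded_scaleR[OF x(1) hy] hat_abs_le)
  have ic: "integrable m (\<lambda>w. hat S n y *\<^sub>R x w)" using x by simp
  have "(LINT w|m. hat S n (y + w) *\<^sub>R x w) = (LINT w|m. hat S n (y + w) *\<^sub>R x w) - (LINT w|m. hat S n y *\<^sub>R x w)"
    using x(2) by simp
  also have "\<dots> = (LINT w|m. (hat S n (y + w) - hat S n y) *\<^sub>R x w)"
    unfolding scaleR_left_diff_distrib by (rule Bochner_Integration.integral_diff[OF iy ic, symmetric])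
  also have "norm \<dots> \<le> (LINT w|m. norm ((hat S n (y + w) - hat S n y) *\<^sub>R x w))" by (rule integral_norm_bound)
  also have "\<dots> \<le> (LINT w|m. norm (x w) / n + norm (x w) * indicator (- S) w)"
  proof (rule integral_mono)
    show "integrable m (\<lambda>w. norm ((hat S n (y + w) - hat S n y) *\<^sub>R x w))"
      unfolding scaleR_left_diff_distrib by (intro integrable_norm Bochner_Integration.integrable_diff iy ic)
    show "integrable m (\<lambda>w. norm (x w) / n + norm (x w) * indicator (- S) w)" using x int by simp
    fix w
    have "\<bar>hat S n (y + w) - hat S n y\<bar> \<le> 1 / n + indicator (- S) w"
    proof (cases "w \<in> S")
      case True
      then show ?thesis using hat_step[of w S n y] S(2) by auto
    next
      case False
      have "\<bar>hat S n (y + w) - hat S n y\<bar> \<le> 1"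
        using hat_bounds[of S n "y + w"] hat_bounds[of S n y] by linarith
      then show ?thesis using False by (simp add: add_increasing)
    qed
    then have "\<bar>hat S n (y + w) - hat S n y\<bar> * norm (x w) \<le> (1 / n + indicator (- S) w) * norm (x w)"
      by (intro mult_right_mono) auto
    then show "norm ((hat S n (y + w) - hat S n y) *\<^sub>R x w) \<le> norm (x w) / n + norm (x w) * indicator (- S) w"
      by (simp only: norm_scaleR real_norm_def) (simp add: algebra_simps)
  qed
  also have "\<dots> = (LINT w|m. norm (x w)) / n + (LINT w|m. norm (x w) * indicator (- S) w)"
    using x int by (subst Bochner_Integration.integral_add) auto
  also have "\<dots> \<le> \<eta>" using tail long by linarith
  finally show "norm (LINT w|m. hat S n (y + w) *\<^sub>R x w) \<le> \<eta>" .
qed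

lemma exists_hat:
  assumes Xs: "set Xs \<subseteq> augmentation_ideal m" and \<eta>: "0 < \<eta>"
  shows "\<exists>S n. finite S \<and> 0 \<in> S \<and> 0 < n \<and> (\<forall>X\<in>set Xs. \<forall>x\<in>X. test_bound m (hat S n) \<eta> x)"
proof -
  let ?V = "\<Union>(set Xs)"
  have V: "integrable m x" "(LINT w|m. x w) = 0" if "x \<in> ?V" for x
    using that Xs by (auto simp: augmentation_iff subset_iff)
  have "finite X" if "X \<in> set Xs" for X using that Xs by (auto simp: augmentation_iff subset_iff)
  then have finV: "finite ?V" by auto
  have "\<forall>x\<in>?V. \<exists>K. finite K \<and> (LINT w|m. norm (x w) * indicator (- K) w) < \<eta> / 2"
    using V(1) finite_tail \<eta> by (meson half_gt_zero)
  then obtain K where K: "\<And>x. x \<in> ?V \<Longrightarrow> finite (K x) \<and> (LINT w|m. norm (x w) * indicator (- K x) w) < \<eta> / 2"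
    by metis
  define T where "T = insert 0 (\<Union>x\<in>?V. K x)"
  define S where "S = T \<union> uminus ` T"
  define n where "n = Suc (nat \<lceil>2 / \<eta> * (\<Sum>x\<in>?V. LINT w|m. norm (x w))\<rceil>)"
  have "finite T" unfolding T_def by (intro finite.insertI finite_UN_I finV) (use K in blast)
  then have finS: "finite S" by (simp add: S_def)
  have [measurable]: "S \<in> sets borel" using finite_imp_closed[OF finS] by (rule borel_closed)
  have "test_bound m (hat S n) \<eta> x" if x: "x \<in> ?V" for x
  proof (rule hat_test_bound[OF V[OF x] finS])
    show "uminus ` S \<subseteq> S" by (auto simp: S_def)
    show "0 < n" by (simp add: n_def)
    have [measurable]: "K x \<in> sets borel" using K[OF x] by (intro borel_closed finite_imp_closed) auto
    have "(LINT w|m. norm (x w) * indicator (- S) w) \<le> (LINT w|m. norm (x w) * indicator (- K x) w)"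
    proof (intro integral_mono integrable_real_mult_indicator integrable_norm V[OF x])
      fix w show "norm (x w) * indicator (- S) w \<le> norm (x w) * indicator (- K x) w"
        using x by (auto simp: S_def T_def split: split_indicator)
    qed auto
    then show "(LINT w|m. norm (x w) * indicator (- S) w) \<le> \<eta> / 2" using K[OF x] by linarith
    have "(LINT w|m. norm (x w)) \<le> (\<Sum>x\<in>?V. LINT w|m. norm (x w))"
      using x finV by (intro member_le_sum) auto
    then have "2 / \<eta> * (LINT w|m. norm (x w)) \<le> 2 / \<eta> * (\<Sum>x\<in>?V. LINT w|m. norm (x w))"
      using \<eta> by (intro mult_left_mono) auto
    also have "\<dots> \<le> n" unfolding n_def by linarith
    finally show "(LINT w|m. norm (x w)) / n \<le> \<eta> / 2"
      using \<eta> by (simp add: n_def field_simps del: of_nat_Suc)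
  qed
  then show ?thesis using finS by (intro exI[of _ S] exI[of _ n]) (auto simp: S_def T_def n_def)
qed

text \<open>
  The function \<open>f\<close> is \<open>\<Sum>\<^sub>j 2\<^sup>-\<^sup>j (1\<^bsub>{0}\<^esub> - 1\<^bsub>{g j}\<^esub>)\<close> with \<open>\<phi>\<^sub>j (g j) = 0\<close>. Its pairing with \<open>\<phi>\<^sub>k\<close> is a sum of positive multiples of
  \<open>1 - \<phi>\<^sub>k (g j) \<ge> 0\<close>, and the \<open>k\<close>-th term is \<open>2\<^sup>-\<^sup>k\<close> times the mass of a point.
\<close>

lemma infinite_not_finitely_generated:
  assumes inf: "infinite (UNIV :: 'g set)"
  shows "\<not> finitely_generated_left_ideal (L1_algebra m) (augmentation_ideal m)"
proof
  assume "finitely_generated_left_ideal (L1_algebra m) (augmentation_ideal m)"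
  then obtain Xs where Xs: "set Xs \<subseteq> carrier (L1_algebra m)"
    "augmentation_ideal m = foldr (sum_sets (L1_algebra m)) (map (left_multiples (L1_algebra m)) Xs) {azero (L1_algebra m)}"
    unfolding finitely_generated_left_ideal_def by blast
  have gens: "set Xs \<subseteq> augmentation_ideal m" using generator_in_ideal[OF Xs(1)] Xs(2) by blast
  have "\<forall>k. \<exists>S n. finite S \<and> 0 \<in> S \<and> 0 < n \<and> (\<forall>X\<in>set Xs. \<forall>x\<in>X. test_bound m (hat S n) ((1/4)^k) x)"
    using exists_hat[OF gens] by simp
  then obtain S n where Sn: "\<And>k. finite (S k) \<and> 0 \<in> S k \<and> 0 < n k"
    "\<And>k::nat. \<forall>X\<in>set Xs. \<forall>x\<in>X. test_bound m (hat (S k) (n k)) ((1/4)^k) x" by metis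
  define \<phi> where "\<phi> k = hat (S k) (n k)" for k
  have \<phi>0: "\<phi> k 0 = 1" for k using Sn(1)[of k] by (simp add: \<phi>_def hat_zero)
  have \<phi>1: "0 \<le> \<phi> k z" "\<phi> k z \<le> 1" for k z by (simp_all add: \<phi>_def hat_bounds)
  have \<phi>fin: "finite {z. \<phi> k z \<noteq> 0}" for k using Sn(1)[of k] by (simp add: \<phi>_def hat_support)
  have "\<exists>g. \<phi> k g = 0" for k
    using ex_new_if_finite[OF inf \<phi>fin[of k]] by auto
  then obtain g where g: "\<And>k. \<phi> k (g k) = 0" by metis
  define d where "d j z = (1/2)^j * (indicator {0} z - indicator {g j} z :: real)" for j z
  define f where "f z = complex_of_real (\<Sum>j. d j z)" for z
  have pair: "integrable m (\<lambda>z. \<psi> z * (\<Sum>j. d j z))"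
     "(\<lambda>j. (1/2)^j * atom_mass * (\<psi> 0 - \<psi> (g j))) sums (LINT z|m. \<psi> z * (\<Sum>j. d j z))"
    if \<psi>: "\<And>z. \<bar>\<psi> z\<bar> \<le> 1" for \<psi> :: "'g \<Rightarrow> real"
  proof -
    have eq: "\<psi> z * d j z = ((1/2)^j * \<psi> 0) * indicator {0} z - ((1/2)^j * \<psi> (g j)) * indicator {g j} z" for j z
      by (auto simp: d_def split: split_indicator)
    have pt: "integrable m (indicator {u} :: 'g \<Rightarrow> real)" "(LINT z|m. indicator {u} z) = atom_mass" for u
      using emeasure_point[of u] atom_mass_pos by (auto simp: measure_def)
    have int: "integrable m (\<lambda>z. \<psi> z * d j z)" for j
      unfolding eq using pt by auto
    have val: "(LINT z|m. \<psi> z * d j z) = (1/2)^j * atom_mass * (\<psi> 0 - \<psi> (g j))" for j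
      unfolding eq using pt by (subst Bochner_Integration.integral_diff) (auto simp: algebra_simps)
    have half: "summable (\<lambda>j. (1/2::real)^j)" by (rule summable_geometric) simp
    have dle: "norm (d j z) \<le> (1/2)^j" for j z by (auto simp: d_def split: split_indicator)
    have sd: "summable (\<lambda>j. d j z)" for z
      using dle by (rule summable_comparison_test'[OF half])
    have nle: "norm (\<psi> z * d j z) \<le> (1/2)^j" for j z
      using mult_mono[OF \<psi>[of z] dle[of j z]] by (simp add: abs_mult)
    have AE: "AE z in m. summable (\<lambda>j. norm (\<psi> z * d j z))"
      by (intro AE_I2 summable_comparison_test'[OF half]) (simp only: real_norm_def abs_idempotent nle[unfolded real_norm_def])
    have sn: "summable (\<lambda>j. LINT z|m. norm (\<psi> z * d j z))"
    proof (rule summable_comparison_test'[of "\<lambda>j. 2 * atom_mass * (1/2)^j" 0])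
      show "summable (\<lambda>j. 2 * atom_mass * (1/2)^j)" by (intro summable_mult half)
      fix j
      have "(LINT z|m. norm (\<psi> z * d j z)) \<le> (LINT z|m. (1/2)^j * indicator {0} z + (1/2)^j * indicator {g j} z)"
      proof (rule integral_mono)
        fix z
        show "norm (\<psi> z * d j z) \<le> (1/2)^j * indicator {0} z + (1/2)^j * indicator {g j} z"
          using nle[of z j] by (auto simp: d_def split: split_indicator)
      qed (use int pt in auto)
      also have "\<dots> = 2 * atom_mass * (1/2)^j" using pt by (subst Bochner_Integration.integral_add) auto
      finally show "norm (LINT z|m. norm (\<psi> z * d j z)) \<le> 2 * atom_mass * (1/2)^j" by simp
    qed
    have pull: "(\<Sum>j. \<psi> z * d j z) = \<psi> z * (\<Sum>j. d j z)" for z by (rule suminf_mult[OF sd])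
    show "integrable m (\<lambda>z. \<psi> z * (\<Sum>j. d j z))"
      using integrable_suminf[OF int AE sn] unfolding pull .
    show "(\<lambda>j. (1/2)^j * atom_mass * (\<psi> 0 - \<psi> (g j))) sums (LINT z|m. \<psi> z * (\<Sum>j. d j z))"
      using sums_integral[OF int AE sn] unfolding pull val .
  qed
  have fint: "integrable m f" using pair(1)[of "\<lambda>z. 1"] unfolding f_def by auto
  have "(\<lambda>j. 0) sums (LINT z|m. (\<Sum>j. d j z))" using pair(2)[of "\<lambda>z. 1"] by simp
  then have "(LINT z|m. (\<Sum>j. d j z)) = 0" using sums_unique2 sums_zero by blast
  then have f0: "(LINT z|m. f z) = 0" unfolding f_def by (simp add: integral_complex_of_real)
  have large: "atom_mass * (1/2)^k \<le> norm (LINT z|m. \<phi> k z *\<^sub>R f z)" for k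
  proof -
    have ab: "\<bar>\<phi> k z\<bar> \<le> 1" for z using \<phi>1[of k z] by simp
    note s = pair(2)[of "\<phi> k", OF ab]
    have "(\<Sum>j\<in>{k}. (1/2)^j * atom_mass * (\<phi> k 0 - \<phi> k (g j))) \<le> (LINT z|m. \<phi> k z * (\<Sum>j. d j z))"
      unfolding sums_unique[OF s] using atom_mass_pos \<phi>1 \<phi>0 by (intro sum_le_suminf sums_summable[OF s]) auto
    then have "atom_mass * (1/2)^k \<le> (LINT z|m. \<phi> k z * (\<Sum>j. d j z))" by (simp add: \<phi>0 g mult.commute)
    moreover have "(LINT z|m. \<phi> k z *\<^sub>R f z) = complex_of_real (LINT z|m. \<phi> k z * (\<Sum>j. d j z))"
      unfolding integral_complex_of_real[symmetric] by (simp add: f_def scaleR_conv_of_real)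
    ultimately show ?thesis by (simp only: norm_of_real)
  qed
  have "L1_class m f \<in> augmentation_ideal m" using fint f0 by (auto simp: augmentation_ideal_def)
  moreover have "\<phi> k \<in> borel_measurable m" for k using finite_support_measurable[OF \<phi>fin] by simp
  ultimately show False
    using test_sequence_contradiction[of m f Xs \<phi> atom_mass] Xs(2) Sn(2) large atom_mass_pos
    by (simp add: \<phi>_def hat_abs_le)
qed

end

section \<open>Finite generation of the augmentation ideal\<close>

theorem corollary1p6:
  fixes m :: "'g::{topological_group_add,t2_space} measure"
  assumes "locally_compact_space (euclidean :: 'g topology)"
    and "left_haar_measure m"
  shows "finitely_generated_left_ideal (L1_algebra m) (augmentation_ideal m)
    \<longleftrightarrow> finite (UNIV :: 'g set)"
proof (cases "emeasure m {0} = 0")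
  case True
  have "infinite (UNIV :: 'g set)"
  proof
    assume "finite (UNIV :: 'g set)"
    then have "open {0 :: 'g}"
      using finite_imp_closed[of "- {0 :: 'g}"] finite_subset[of "- {0 :: 'g}" UNIV] by (simp add: closed_def)
    then show False using haar_open_pos[OF assms(2), of "{0}"] True by simp
  qed
  then show ?thesis using nonatomic_not_finitely_generated[OF assms(2) True] by blast
next
  case False
  interpret atomic_haar m by unfold_locales (rule assms(2) False)+
  show ?thesis using augmentation_ideal_principal infinite_not_finitely_generated by blast
qed

end
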